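(* Let $n\ge1$ and let $(\mathbb{R}^{2n+1},H,g)$ be a left-invariant contact sub-pseudo-Riemannian structure on the Heisenberg group, where $H=\mathrm{span}\{X_1,Y_1,\dots,X_n,Y_n\}$ and $g$ is the metric on $H$ for which $(X_1,Y_1,\dots,X_n,Y_n)$ is orthogonal with $g(X_i,X_i)=t_i$ and $g(Y_i,Y_i)=s_i$, for arbitrary signs $t_i,s_i\in\{-1,1\}$. Then the group of orientation preserving isometries of $(\mathbb{R}^{2n+1},H,g)$ is isomorphic to $$\mathbb{R}^{2n+1}\ltimes\big(Sp(\omega)\cap O(g)\big),$$ where the first factor is the Heisenberg group acting by left translations, and $\sigma\in Sp(\omega)\cap O(g)$ acts by $f_\sigma(x,y,z)=(\sigma\cdot(x,y)^T,z)$.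
   Context: The Heisenberg group is $\mathbb{R}^{2n+1}$ with coordinates $(x,y,z)=(x_1,\dots,x_n,y_1,\dots,y_n,z)$ and multiplication $$(x,y,z)*(x',y',z')=\Big(x+x',\,y+y',\,z+z'+\tfrac12\sum_{i=1}^n(y_ix_i'-y_i'x_i)\Big).$$ The vector fields $X_i=\frac{\partial}{\partial x_i}+\frac12y_i\frac{\partial}{\partial z}$, $Y_i=\frac{\partial}{\partial y_i}-\frac12x_i\frac{\partial}{\partial z}$ are left-invariant; $H$ is a contact distribution, and $\omega=\sum_{i=1}^ndx_i\wedge dy_i$ is the symplectic form on $H$. $Sp(\omega)\cap O(g)$ is the group of real $2n\times2n$ matrices $\sigma$ which, acting on the fibres of $H$ in the basis $(X_1,\dots,X_n,Y_1,\dots,Y_n)$, preserve both $\omega$ and $g$ (both have constant coefficients in this basis). An isometry is a diffeomorphism $f$ with $f_*(H)=H$ and $g(f_*v,f_*w)=g(v,w)$ for all $v,w\in H_q$ and all $q$. The manifold and the bundle $H$ are oriented by $(d\alpha)^{\wedge n}\wedge\alpha$ and $(d\alpha)^{\wedge n}|_H$ respectively, where $\alpha=dz-\frac12\sum_{i=1}^n(y_i\,dx_i-x_i\,dy_i)$ is a global contact form annihilating $H$. An isometry is orientation preserving if it preserves the orientations of both $T\mathbb{R}^{2n+1}$ and $H$. *)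

theory Defs
  imports
    "HOL-Analysis.Analysis"
    "HOL-Combinatorics.Permutations"
    "HOL-Algebra.Group"
begin

section \<open>Smooth maps and diffeomorphisms\<close>

primrec Ck :: "nat \<Rightarrow> ('a::euclidean_space \<Rightarrow> 'b::euclidean_space) \<Rightarrow> bool" where
  "Ck 0 f \<longleftrightarrow> continuous_on UNIV f"
| "Ck (Suc k) f \<longleftrightarrow>
     (\<forall>x. f differentiable at x) \<and> (\<forall>v. Ck k (\<lambda>x. frechet_derivative f (at x) v))"

definition smooth :: "('a::euclidean_space \<Rightarrow> 'b::euclidean_space) \<Rightarrow> bool" where
  "smooth f \<longleftrightarrow> (\<forall>k. Ck k f)"

(* inv_into UNIV f is the ordinary inverse function; the prefix notation for it clashes with
   the inverse of HOL-Algebra. *)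
definition diffeomorphism :: "('a::euclidean_space \<Rightarrow> 'a) \<Rightarrow> bool" where
  "diffeomorphism f \<longleftrightarrow> bij f \<and> smooth f \<and> smooth (inv_into UNIV f)"

abbreviation pushforward :: "('a::euclidean_space \<Rightarrow> 'a) \<Rightarrow> 'a \<Rightarrow> 'a \<Rightarrow> 'a" where
  "pushforward f q \<equiv> frechet_derivative f (at q)"


section \<open>Alternating forms\<close>

(* A k-form on a vector space is represented as a function of a sequence of vectors
   that only reads the entries 0, ..., k - 1. *)
type_synonym 'v form = "(nat \<Rightarrow> 'v) \<Rightarrow> real"

definition form1 :: "('v \<Rightarrow> real) \<Rightarrow> 'v form" where
  "form1 \<theta> v = \<theta> (v 0)"

definition form2 :: "('v \<Rightarrow> 'v \<Rightarrow> real) \<Rightarrow> 'v form" where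
  "form2 \<beta> v = \<beta> (v 0) (v 1)"

definition wedge :: "nat \<Rightarrow> nat \<Rightarrow> 'v form \<Rightarrow> 'v form \<Rightarrow> 'v form" where
  "wedge k l \<beta> \<gamma> v =
     (\<Sum>\<pi> | \<pi> permutes {..<k + l}.
        of_int (sign \<pi>) * \<beta> (\<lambda>i. v (\<pi> i)) * \<gamma> (\<lambda>i. v (\<pi> (k + i)))) / (fact k * fact l)"

(* The m-th exterior power of a 2-form. *)
primrec wedge_power2 :: "'v form \<Rightarrow> nat \<Rightarrow> 'v form" where
  "wedge_power2 \<beta> 0 = (\<lambda>v. 1)"
| "wedge_power2 \<beta> (Suc m) = wedge 2 (2 * m) \<beta> (wedge_power2 \<beta> m)"

(* d theta (V, W) = V (theta W) - W (theta V) - theta [V, W] for the constant vector fields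
   V = v and W = w, for which the bracket vanishes. *)
definition exterior_derivative1 ::
  "('a::euclidean_space \<Rightarrow> 'a \<Rightarrow> real) \<Rightarrow> 'a \<Rightarrow> 'a \<Rightarrow> 'a \<Rightarrow> real" where
  "exterior_derivative1 \<theta> q v w =
     frechet_derivative (\<lambda>p. \<theta> p w) (at q) v - frechet_derivative (\<lambda>p. \<theta> p v) (at q) w"


section \<open>The Heisenberg group\<close>

(* Points (x, y, z) of R^(2n+1) with n = CARD('n); tangent vectors at any point have the
   same type, with components along d/dx_i, d/dy_i, d/dz. *)
type_synonym 'n heis = "(real ^ 'n) \<times> (real ^ 'n) \<times> real"

definition xc :: "'n::finite heis \<Rightarrow> 'n \<Rightarrow> real" where "xc p i = fst p $ i"
definition yc :: "'n::finite heis \<Rightarrow> 'n \<Rightarrow> real" where "yc p i = fst (snd p) $ i"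
definition zc :: "'n::finite heis \<Rightarrow> real" where "zc p = snd (snd p)"

definition heis_mult :: "'n::finite heis \<Rightarrow> 'n heis \<Rightarrow> 'n heis" where
  "heis_mult p q =
     (fst p + fst q,
      fst (snd p) + fst (snd q),
      zc p + zc q + (1/2) * (\<Sum>i\<in>UNIV. yc p i * xc q i - yc q i * xc p i))"

definition heis_group :: "('n::finite heis) monoid" where
  "heis_group = \<lparr>carrier = UNIV, mult = heis_mult, one = 0\<rparr>"

definition X_field :: "'n::finite \<Rightarrow> 'n heis \<Rightarrow> 'n heis" where
  "X_field i q = (axis i 1, 0, (1/2) * yc q i)"

definition Y_field :: "'n::finite \<Rightarrow> 'n heis \<Rightarrow> 'n heis" where
  "Y_field i q = (0, axis i 1, - (1/2) * xc q i)"

definition heis_H :: "'n::finite heis \<Rightarrow> ('n heis) set" where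
  "heis_H q = span (range (\<lambda>i. X_field i q) \<union> range (\<lambda>i. Y_field i q))"

definition heis_alpha :: "'n::finite heis \<Rightarrow> 'n heis \<Rightarrow> real" where
  "heis_alpha q v = zc v - (1/2) * (\<Sum>i\<in>UNIV. yc q i * xc v i - xc q i * yc v i)"

definition heis_omega :: "'n::finite heis \<Rightarrow> 'n heis \<Rightarrow> real" where
  "heis_omega v w = (\<Sum>i\<in>UNIV. xc v i * yc w i - yc v i * xc w i)"


section \<open>The sub-pseudo-Riemannian metric\<close>

definition symmetric_bilinear_on :: "'v::real_vector set \<Rightarrow> ('v \<Rightarrow> 'v \<Rightarrow> real) \<Rightarrow> bool" where
  "symmetric_bilinear_on S b \<longleftrightarrow>
     (\<forall>u\<in>S. \<forall>v\<in>S. b u v = b v u) \<and>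
     (\<forall>u\<in>S. \<forall>v\<in>S. \<forall>w\<in>S. b (u + v) w = b u w + b v w) \<and>
     (\<forall>c. \<forall>u\<in>S. \<forall>v\<in>S. b (c *\<^sub>R u) v = c * b u v)"

(* Only the values of g q on heis_H q matter.  They are determined by the conditions below;
   nondegeneracy (for t i, s i in {-1, 1}), smoothness and left-invariance of g are
   consequences. *)
definition heis_metric ::
  "('n::finite \<Rightarrow> real) \<Rightarrow> ('n \<Rightarrow> real) \<Rightarrow> ('n heis \<Rightarrow> 'n heis \<Rightarrow> 'n heis \<Rightarrow> real) \<Rightarrow> bool" where
  "heis_metric t s g \<longleftrightarrow>
     (\<forall>q. symmetric_bilinear_on (heis_H q) (g q) \<and>
        (\<forall>i j. g q (X_field i q) (X_field j q) = (if i = j then t i else 0)) \<and>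
        (\<forall>i j. g q (Y_field i q) (Y_field j q) = (if i = j then s i else 0)) \<and>
        (\<forall>i j. g q (X_field i q) (Y_field j q) = 0))"


section \<open>Orientation preserving isometries\<close>

definition isometry ::
  "('a::euclidean_space \<Rightarrow> 'a set) \<Rightarrow> ('a \<Rightarrow> 'a \<Rightarrow> 'a \<Rightarrow> real) \<Rightarrow> ('a \<Rightarrow> 'a) \<Rightarrow> bool" where
  "isometry H g f \<longleftrightarrow>
     diffeomorphism f \<and>
     (\<forall>q. pushforward f q ` H q = H (f q)) \<and>
     (\<forall>q. \<forall>v\<in>H q. \<forall>w\<in>H q. g (f q) (pushforward f q v) (pushforward f q w) = g q v w)"

(* The forms (d alpha)^n and (d alpha)^n wedge alpha at q, orienting H q and the tangent
   space; a frame is positively oriented if the form is positive on it. *)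
definition heis_H_form :: "'n::finite heis \<Rightarrow> ('n heis) form" where
  "heis_H_form q = wedge_power2 (form2 (exterior_derivative1 heis_alpha q)) CARD('n)"

definition heis_volume_form :: "'n::finite heis \<Rightarrow> ('n heis) form" where
  "heis_volume_form q = wedge (2 * CARD('n)) 1 (heis_H_form q) (form1 (heis_alpha q))"

definition orientation_preserving :: "('n::finite heis \<Rightarrow> 'n heis) \<Rightarrow> bool" where
  "orientation_preserving f \<longleftrightarrow>
     (\<forall>q v. heis_volume_form q v > 0 \<longrightarrow>
        heis_volume_form (f q) (\<lambda>i. pushforward f q (v i)) > 0) \<and>
     (\<forall>q v. (\<forall>i < 2 * CARD('n). v i \<in> heis_H q) \<and> heis_H_form q v > 0 \<longrightarrow>
        heis_H_form (f q) (\<lambda>i. pushforward f q (v i)) > 0)"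

definition oriented_isometry_group ::
  "('n::finite heis \<Rightarrow> 'n heis \<Rightarrow> 'n heis \<Rightarrow> real) \<Rightarrow> ('n heis \<Rightarrow> 'n heis) monoid" where
  "oriented_isometry_group g =
     \<lparr>carrier = {f. isometry heis_H g f \<and> orientation_preserving f}, mult = (\<circ>), one = id\<rparr>"


section \<open>The group of linear symplectic isometries\<close>

(* Coordinates on R^(2n) are indexed by 'n + 'n, with Inl i belonging to x_i (or X_i) and
   Inr i to y_i (or Y_i). *)
definition heis_frame :: "'n::finite heis \<Rightarrow> real ^ ('n + 'n) \<Rightarrow> 'n heis" where
  "heis_frame q u =
     (\<Sum>i\<in>UNIV. (u $ Inl i) *\<^sub>R X_field i q + (u $ Inr i) *\<^sub>R Y_field i q)"

definition Sp_omega :: "(real ^ ('n::finite + 'n) ^ ('n + 'n)) set" where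
  "Sp_omega = {\<sigma>. \<forall>q u v.
     heis_omega (heis_frame q (\<sigma> *v u)) (heis_frame q (\<sigma> *v v))
       = heis_omega (heis_frame q u) (heis_frame q v)}"

definition O_metric ::
  "('n::finite heis \<Rightarrow> 'n heis \<Rightarrow> 'n heis \<Rightarrow> real) \<Rightarrow> (real ^ ('n + 'n) ^ ('n + 'n)) set" where
  "O_metric g = {\<sigma>. \<forall>q u v.
     g q (heis_frame q (\<sigma> *v u)) (heis_frame q (\<sigma> *v v))
       = g q (heis_frame q u) (heis_frame q v)}"

definition SpO_group ::
  "('n::finite heis \<Rightarrow> 'n heis \<Rightarrow> 'n heis \<Rightarrow> real) \<Rightarrow> (real ^ ('n + 'n) ^ ('n + 'n)) monoid" where
  "SpO_group g = \<lparr>carrier = Sp_omega \<inter> O_metric g, mult = (**), one = mat 1\<rparr>"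

definition f_sigma :: "real ^ ('n::finite + 'n) ^ ('n + 'n) \<Rightarrow> 'n heis \<Rightarrow> 'n heis" where
  "f_sigma \<sigma> p =
     (let w = \<sigma> *v (\<chi> k. case k of Inl i \<Rightarrow> xc p i | Inr i \<Rightarrow> yc p i)
      in ((\<chi> i. w $ Inl i), (\<chi> i. w $ Inr i), zc p))"


section \<open>Semidirect products\<close>

definition semidirect ::
  "('a, 'c) monoid_scheme \<Rightarrow> ('b, 'd) monoid_scheme \<Rightarrow> ('b \<Rightarrow> 'a \<Rightarrow> 'a) \<Rightarrow> ('a \<times> 'b) monoid" where
  "semidirect N K \<phi> =
     \<lparr>carrier = carrier N \<times> carrier K,
      mult = (\<lambda>(a, k) (b, l). (a \<otimes>\<^bsub>N\<^esub> \<phi> k b, k \<otimes>\<^bsub>K\<^esub> l)),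
      one = (\<one>\<^bsub>N\<^esub>, \<one>\<^bsub>K\<^esub>)\<rparr>"


section \<open>Basic facts\<close>

lemma exterior_derivative_heis_alpha:
  "exterior_derivative1 heis_alpha q v w = heis_omega v w"
proof -
  have d: "frechet_derivative (\<lambda>p. heis_alpha p u) (at q)
      = (\<lambda>h. - (1/2) * (\<Sum>i\<in>UNIV. yc h i * xc u i - xc h i * yc u i))" for u :: "'a heis"
  proof (rule frechet_derivative_at[symmetric])
    have x: "((\<lambda>p. xc p i) has_derivative (\<lambda>h. xc h i)) (at q)"
      and y: "((\<lambda>p. yc p i) has_derivative (\<lambda>h. yc h i)) (at q)" for i :: 'a
      unfolding xc_def yc_def
      by (intro bounded_linear_imp_has_derivative bounded_linear_compose[OF bounded_linear_vec_nth]
          bounded_linear_fst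
          bounded_linear_compose[OF bounded_linear_fst] bounded_linear_snd)+
    show "((\<lambda>p. heis_alpha p u) has_derivative
        (\<lambda>h. - (1/2) * (\<Sum>i\<in>UNIV. yc h i * xc u i - xc h i * yc u i))) (at q)"
      unfolding heis_alpha_def
      by (rule derivative_eq_intros refl x y)+ simp
  qed
  show ?thesis
    unfolding exterior_derivative1_def d heis_omega_def
    by (simp add: sum_subtractf algebra_simps)
qed

lemma heis_alpha_annihilates:
  assumes "v \<in> heis_H q" shows "heis_alpha q v = 0"
  using assms unfolding heis_H_def
proof (induction rule: span_induct)
  case base
  have "linear (heis_alpha q)"
    by (rule linearI)
       (simp_all add: heis_alpha_def xc_def yc_def zc_def ring_distribs sum.distrib
          sum_subtractf sum_distrib_left mult.left_commute)
  then show ?case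
    by (rule linear_subspace_kernel)
next
  case (step v)
  have *: "(\<Sum>k\<in>UNIV. c k * axis i 1 $ k) = c i" for c :: "'a \<Rightarrow> real" and i
  proof -
    have "(\<Sum>k\<in>UNIV. c k * axis i 1 $ k) = (\<Sum>k\<in>UNIV. if k = i then c i else 0)"
      by (rule sum.cong) (auto simp: axis_def)
    then show ?thesis
      by simp
  qed
  show ?case
    using step
    by (auto simp: heis_alpha_def X_field_def Y_field_def xc_def yc_def zc_def * sum_negf)
qed

lemma heis_metric_exists:
  "heis_metric t s (\<lambda>q v w. \<Sum>i\<in>UNIV. t i * xc v i * xc w i + s i * yc v i * yc w i)"
proof -
  have *: "(\<Sum>k\<in>UNIV. c k * axis i 1 $ k * axis j 1 $ k) = (if i = j then c i else 0)"
    for c :: "'a \<Rightarrow> real" and i j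
  proof -
    have "(\<Sum>k\<in>UNIV. c k * axis i 1 $ k * axis j 1 $ k)
        = (\<Sum>k\<in>UNIV. if k = i then (if i = j then c i else 0) else 0)"
      by (rule sum.cong) (auto simp: axis_def)
    then show ?thesis
      by simp
  qed
  show ?thesis
    unfolding heis_metric_def symmetric_bilinear_on_def
    by (auto simp: X_field_def Y_field_def xc_def yc_def * sum.distrib sum_distrib_left
        ring_distribs mult_ac *[unfolded mult.assoc])
qed

end

theory Submission
  imports Defs
begin

text \<open>
  Write \<open>\<omega> = d\<alpha>\<close> and let \<open>f\<close> be an isometry. It preserves \<open>H\<close>, the kernel of \<open>\<alpha>\<close>, so
  \<open>f\<^sup>*\<alpha> = \<phi> \<alpha>\<close> for a function \<open>\<phi>\<close>; taking the exterior derivative (lemma \<open>omega_D\<close>, which rests on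
  the symmetry of second derivatives) shows that the differential of \<open>f\<close> scales \<open>\<omega>\<close> on \<open>H\<close> by
  \<open>\<phi>\<close>. But it also preserves the metric on \<open>H\<close>. The operator that relates \<open>\<omega>\<close> and the metric has
  fourth power 1, and this forces \<open>\<phi> = \<plusminus>1\<close> (\<open>symplectic_similitude_factor\<close>). In particular
  \<open>d\<phi> = 0\<close>, hence \<open>f\<^sup>*\<omega> = \<phi> \<omega>\<close> on all tangent vectors, and \<open>f\<close> multiplies the two orientation
  forms by \<open>\<phi>\<^sup>n\<close> and \<open>\<phi>\<^sup>n\<^sup>+\<^sup>1\<close>. Both forms are positive on some frame (\<open>positive_frame\<close>), so \<open>\<phi> = 1\<close> if
  \<open>f\<close> preserves both orientations.

  Now \<open>f\<close> preserves \<open>\<alpha>\<close> and \<open>\<omega>\<close>. The kernel of \<open>\<omega>\<close> is the central direction, so the horizontal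
  part of the differential of \<open>f\<close> only sees horizontal components, on which it is an isometry of a
  constant metric on \<open>\<real>\<^sup>2\<^sup>n\<close>. Isometries of a flat metric, of whatever signature, have vanishing
  second derivative (\<open>horiz_D2\<close>). So the horizontal part of \<open>f\<close> is affine, with linear part \<open>\<sigma>\<close> in
  \<open>Sp(\<omega>) \<inter> O(g)\<close>, and preservation of \<open>\<alpha>\<close> determines the rest: \<open>f\<close> is \<open>f_sigma \<sigma>\<close> followed by the
  left translation by \<open>f 0\<close> (\<open>heis_motion\<close>).

  Conversely all these maps, called motions below, are affine and preserve \<open>\<alpha>\<close>, \<open>\<omega>\<close> and \<open>g\<close>. A motion
  determines its translation and its matrix, and the composition of motions is the product of the
  semidirect product because \<open>f_sigma \<sigma>\<close> is an automorphism of the Heisenberg group. The group laws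
  of the isometries are transported along this bijection.
\<close>

section \<open>Horizontal and vertical coordinates\<close>

text \<open>The projection along the centre of the group. It maps each fibre of \<open>H\<close> isomorphically onto
  \<open>\<real>\<^sup>2\<^sup>n\<close>, and on that fibre it gives the coordinates with respect to the left-invariant frame.\<close>

definition horiz :: "'n::finite heis \<Rightarrow> real ^ ('n + 'n)" where
  "horiz p = (\<chi> k. case k of Inl i \<Rightarrow> xc p i | Inr i \<Rightarrow> yc p i)"

definition heis_of :: "real ^ ('n::finite + 'n) \<Rightarrow> real \<Rightarrow> 'n heis" where
  "heis_of u z = ((\<chi> i. u $ Inl i), (\<chi> i. u $ Inr i), z)"

definition sympl :: "real ^ ('n::finite + 'n) \<Rightarrow> real ^ ('n + 'n) \<Rightarrow> real" where
  "sympl u v = (\<Sum>i\<in>UNIV. u $ Inl i * v $ Inr i - u $ Inr i * v $ Inl i)"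

lemma horiz_nth [simp]: "horiz p $ Inl i = xc p i" "horiz p $ Inr i = yc p i"
  by (simp_all add: horiz_def)

lemma horiz_heis_of [simp]: "horiz (heis_of u z) = u"
  by (simp add: vec_eq_iff horiz_def heis_of_def xc_def yc_def split: sum.split)

lemma zc_heis_of [simp]: "zc (heis_of u z) = z"
  by (simp add: heis_of_def zc_def)

lemma heis_eq_iff: "p = q \<longleftrightarrow> horiz p = horiz q \<and> zc p = zc q"
proof
  assume *: "horiz p = horiz q \<and> zc p = zc q"
  have "xc p i = xc q i" "yc p i = yc q i" for i
    using * by (metis horiz_nth)+
  with * show "p = q"
    by (simp add: prod_eq_iff vec_eq_iff xc_def yc_def zc_def)
qed simp

lemma linear_horiz: "linear horiz"
  by (rule linearI) (simp_all add: vec_eq_iff horiz_def xc_def yc_def split: sum.split)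

lemma linear_zc: "linear zc"
  by (rule linearI) (simp_all add: zc_def)

lemmas horiz_linear_simps [simp] =
  linear_add[OF linear_horiz] linear_diff[OF linear_horiz] linear_cmul[OF linear_horiz]
  linear_0[OF linear_horiz]
  linear_add[OF linear_zc] linear_diff[OF linear_zc] linear_cmul[OF linear_zc]
  linear_0[OF linear_zc]

lemma bounded_linear_horiz: "bounded_linear horiz"
  using linear_horiz by (simp add: linear_conv_bounded_linear)

lemma bounded_linear_zc: "bounded_linear zc"
  using linear_zc by (simp add: linear_conv_bounded_linear)

lemma sympl_bilinear: "bilinear sympl"
  unfolding bilinear_def
  by (auto intro!: linearI
      simp: sympl_def algebra_simps sum.distrib sum_distrib_left sum_subtractf)

lemmas sympl_simps =
  bilinear_ladd[OF sympl_bilinear] bilinear_radd[OF sympl_bilinear]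
  bilinear_lsub[OF sympl_bilinear] bilinear_rsub[OF sympl_bilinear]
  bilinear_lmul[OF sympl_bilinear] bilinear_rmul[OF sympl_bilinear]
  bilinear_lzero[OF sympl_bilinear] bilinear_rzero[OF sympl_bilinear]

lemma sympl_bounded_bilinear: "bounded_bilinear sympl"
  using sympl_bilinear bilinear_conv_bounded_bilinear by blast

lemma sympl_commute: "sympl v u = - sympl u v"
  unfolding sympl_def sum_negf [symmetric] by (rule sum.cong) auto

lemma heis_omega_sympl: "heis_omega v w = sympl (horiz v) (horiz w)"
  by (simp add: heis_omega_def sympl_def)

lemma heis_alpha_sympl: "heis_alpha q v = zc v + sympl (horiz q) (horiz v) / 2"
  by (simp add: heis_alpha_def sympl_def sum_subtractf field_simps)

lemma f_sigma_heis_of: "f_sigma \<sigma> p = heis_of (\<sigma> *v horiz p) (zc p)"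
  by (simp add: f_sigma_def horiz_def heis_of_def Let_def)

lemma horiz_f_sigma [simp]: "horiz (f_sigma \<sigma> p) = \<sigma> *v horiz p"
  and zc_f_sigma [simp]: "zc (f_sigma \<sigma> p) = zc p"
  by (simp_all add: f_sigma_heis_of)

lemma horiz_heis_mult [simp]: "horiz (heis_mult p q) = horiz p + horiz q"
  by (simp add: vec_eq_iff horiz_def heis_mult_def xc_def yc_def split: sum.split)

lemma zc_heis_mult [simp]:
  "zc (heis_mult p q) = zc p + zc q - sympl (horiz p) (horiz q) / 2"
  by (simp add: heis_mult_def zc_def sympl_def sum_subtractf field_simps)

lemma sum_mult_axis: "(\<Sum>k\<in>UNIV. c k * axis i 1 $ k) = (c i :: real)"
proof -
  have "(\<Sum>k\<in>UNIV. c k * axis i 1 $ k) = (\<Sum>k\<in>UNIV. if k = i then c i else 0)"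
    by (rule sum.cong) (auto simp: axis_def)
  then show ?thesis by simp
qed

lemma horiz_X_field [simp]: "horiz (X_field i q) = axis (Inl i) 1"
  and horiz_Y_field [simp]: "horiz (Y_field i q) = axis (Inr i) 1"
  by (auto simp: vec_eq_iff horiz_def X_field_def Y_field_def xc_def yc_def axis_def
      split: sum.split)

lemma frame_in_heis_H: "X_field i q \<in> heis_H q" "Y_field i q \<in> heis_H q"
  unfolding heis_H_def by (auto intro: span_base)

lemma heis_frame_in_heis_H: "heis_frame q u \<in> heis_H q"
  unfolding heis_frame_def heis_H_def
  by (intro span_sum span_add span_scale) (auto intro: span_base)

lemma horiz_heis_frame [simp]: "horiz (heis_frame q u) = u"
proof -
  have "horiz (heis_frame q u)
      = (\<Sum>i\<in>UNIV. u $ Inl i *\<^sub>R axis (Inl i) 1 + u $ Inr i *\<^sub>R axis (Inr i) 1)"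
    unfolding heis_frame_def linear_sum[OF linear_horiz] by simp
  also have "\<dots> = u"
  proof -
    have "(\<Sum>i\<in>UNIV. u $ Inl i * axis (Inl i) 1 $ k + u $ Inr i * axis (Inr i) 1 $ k) = u $ k" for k
    proof (cases k)
      case (Inl j)
      have "(\<Sum>i\<in>UNIV. u $ Inl i * axis (Inl i) 1 $ k + u $ Inr i * axis (Inr i) 1 $ k)
          = (\<Sum>i\<in>UNIV. if i = j then u $ Inl i else 0)"
        by (rule sum.cong) (auto simp: axis_def Inl)
      then show ?thesis using Inl by simp
    next
      case (Inr j)
      have "(\<Sum>i\<in>UNIV. u $ Inl i * axis (Inl i) 1 $ k + u $ Inr i * axis (Inr i) 1 $ k)
          = (\<Sum>i\<in>UNIV. if i = j then u $ Inr i else 0)"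
        by (rule sum.cong) (auto simp: axis_def Inr)
      then show ?thesis using Inr by simp
    qed
    then show ?thesis by (simp add: vec_eq_iff)
  qed
  finally show ?thesis .
qed

lemma heis_alpha_heis_frame [simp]: "heis_alpha q (heis_frame q u) = 0"
  by (rule heis_alpha_annihilates[OF heis_frame_in_heis_H])

lemma zc_heis_frame: "zc (heis_frame q u) = - sympl (horiz q) u / 2"
  using heis_alpha_heis_frame[of q u] by (simp add: heis_alpha_sympl)

lemma heis_frame_horiz:
  assumes "heis_alpha q v = 0" shows "heis_frame q (horiz v) = v"
  using assms by (simp add: heis_eq_iff zc_heis_frame heis_alpha_sympl)

lemma heis_H_iff: "v \<in> heis_H q \<longleftrightarrow> heis_alpha q v = 0"
  using heis_alpha_annihilates heis_frame_horiz heis_frame_in_heis_H by metis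

lemma linear_heis_frame: "linear (heis_frame q)"
  by (rule linearI) (simp_all add: heis_eq_iff zc_heis_frame sympl_simps field_simps)

lemma linear_heis_alpha: "linear (heis_alpha q)"
  by (rule linearI) (simp_all add: heis_alpha_sympl sympl_simps field_simps)

section \<open>The metric in the left-invariant frame\<close>

definition flat_metric :: "('k::finite \<Rightarrow> real) \<Rightarrow> real ^ 'k \<Rightarrow> real ^ 'k \<Rightarrow> real" where
  "flat_metric d u v = (\<Sum>k\<in>UNIV. d k * u $ k * v $ k)"

lemma bilinear_flat_metric: "bilinear (flat_metric d)"
  unfolding bilinear_def
  by (auto intro!: linearI simp: flat_metric_def algebra_simps sum.distrib sum_distrib_left)

lemma flat_metric_commute: "flat_metric d u v = flat_metric d v u"
  by (simp add: flat_metric_def mult_ac)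

lemma flat_metric_axis: "flat_metric d u (axis k 1) = d k * u $ k"
  unfolding flat_metric_def by (rule sum_mult_axis)

lemma flat_metric_nondegenerate:
  assumes "\<And>k. d k \<noteq> 0" and "\<And>v. flat_metric d u v = 0"
  shows "u = 0"
  using assms flat_metric_axis[of d u] by (metis mult_eq_0_iff vec_eq_iff zero_index)

lemma sympl_axis [simp]:
  "sympl u (axis (Inr i) 1) = u $ Inl i" "sympl u (axis (Inl i) 1) = - u $ Inr i"
proof -
  have "sympl u (axis (Inr i) 1) = (\<Sum>k\<in>UNIV. if k = i then u $ Inl i else 0)"
    unfolding sympl_def by (rule sum.cong) (auto simp: axis_def)
  then show "sympl u (axis (Inr i) 1) = u $ Inl i" by simp
  have "sympl u (axis (Inl i) 1) = (\<Sum>k\<in>UNIV. if k = i then - u $ Inr i else 0)"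
    unfolding sympl_def by (rule sum.cong) (auto simp: axis_def)
  then show "sympl u (axis (Inl i) 1) = - u $ Inr i" by simp
qed

lemma sympl_nondegenerate:
  assumes "\<And>v. sympl u v = 0" shows "u = 0"
proof -
  have "u $ k = 0" for k
    using assms[of "axis (Inr (projl k)) 1"] assms[of "axis (Inl (projr k)) 1"] by (cases k) auto
  then show ?thesis by (simp add: vec_eq_iff)
qed

lemma sum_UNIV_sum:
  fixes c :: "'n::finite + 'n \<Rightarrow> real"
  shows "(\<Sum>k\<in>UNIV. c k) = (\<Sum>i\<in>UNIV. c (Inl i) + c (Inr i))"
  using sum.Plus[of "UNIV :: 'n set" "UNIV :: 'n set" c] by (simp add: sum.distrib)

text \<open>The hypotheses on the metric prescribe it on a frame of \<open>H\<close>; bilinearity, available on the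
  fibre only, extends this to the span. So \<open>g\<close> may be replaced by the constant form
  \<open>flat_metric\<close> in horizontal coordinates.\<close>

lemma heis_metric_unique:
  fixes g g' :: "'n::finite heis \<Rightarrow> 'n heis \<Rightarrow> 'n heis \<Rightarrow> real"
  assumes g: "heis_metric t s g" and g': "heis_metric t s g'"
    and v: "v \<in> heis_H q" and w: "w \<in> heis_H q"
  shows "g q v w = g' q v w"
proof -
  let ?F = "range (\<lambda>i. X_field i q) \<union> range (\<lambda>i. Y_field i q)"
  have F: "b \<in> heis_H q" if "b \<in> ?F" for b
    using that by (elim UnE rangeE) (simp_all add: frame_in_heis_H)
  have sub: "subspace (heis_H q)"
    by (simp add: heis_H_def)
  have sym: "h q v w = h q w v" if "heis_metric t s h" "v \<in> heis_H q" "w \<in> heis_H q"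
    for h :: "'n heis \<Rightarrow> 'n heis \<Rightarrow> 'n heis \<Rightarrow> real" and v w
    using that unfolding heis_metric_def symmetric_bilinear_on_def by blast
  \<comment> \<open>Agreement on a set of first arguments spreads to its span.\<close>
  have spread: "g q v w = g' q v w"
    if w: "w \<in> heis_H q" and agree: "\<And>b. b \<in> ?F \<Longrightarrow> g q b w = g' q b w"
      and v: "v \<in> heis_H q" for v w
  proof -
    have lin: "h q (u + u') w = h q u w + h q u' w" "h q (c *\<^sub>R u) w = c * h q u w"
      if "heis_metric t s h" "u \<in> heis_H q" "u' \<in> heis_H q"
      for h :: "'n heis \<Rightarrow> 'n heis \<Rightarrow> 'n heis \<Rightarrow> real" and u u' c
      using that w unfolding heis_metric_def symmetric_bilinear_on_def by blast+
    have "v \<in> span ?F"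
      using v by (simp add: heis_H_def)
    then have "v \<in> heis_H q \<and> g q v w = g' q v w"
    proof (induction rule: span_induct_alt)
      case base
      show ?case
        using lin(2)[OF g, of 0 0 0] lin(2)[OF g', of 0 0 0] subspace_0[OF sub] by simp
    next
      case (step c x y)
      then have x: "c *\<^sub>R x \<in> heis_H q" "x \<in> heis_H q" "y \<in> heis_H q"
        using F[OF step(1)] subspace_scale[OF sub] by simp_all
      then show ?case
        using step lin[OF g] lin[OF g'] agree[OF step(1)] subspace_add[OF sub] by simp
    qed
    then show ?thesis by simp
  qed
  have frame: "h q (X_field i q) (X_field j q) = (if i = j then t i else 0)"
      "h q (Y_field i q) (Y_field j q) = (if i = j then s i else 0)"
      "h q (X_field i q) (Y_field j q) = 0" "h q (Y_field j q) (X_field i q) = 0"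
    if "heis_metric t s h" for h :: "'n heis \<Rightarrow> 'n heis \<Rightarrow> 'n heis \<Rightarrow> real" and i j
  proof -
    show "h q (X_field i q) (X_field j q) = (if i = j then t i else 0)"
      "h q (Y_field i q) (Y_field j q) = (if i = j then s i else 0)"
      and *: "h q (X_field i q) (Y_field j q) = 0"
      using that unfolding heis_metric_def by blast+
    then show "h q (Y_field j q) (X_field i q) = 0"
      using sym[OF that] frame_in_heis_H by metis
  qed
  have basis: "g q b c = g' q b c" if "b \<in> ?F" "c \<in> ?F" for b c
    using that by (elim UnE rangeE) (simp_all add: frame[OF g] frame[OF g'])
  have "g q b v = g' q b v" if b: "b \<in> ?F" for b
  proof -
    have "g q v b = g' q v b"
      using spread[OF F[OF b] basis[OF _ b] v] .
    then show ?thesis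
      using sym[OF g v F[OF b]] sym[OF g' v F[OF b]] by simp
  qed
  from spread[OF v this w] show ?thesis
    using sym[OF g v w] sym[OF g' v w] by simp
qed

lemma case_sum_signs_nonzero:
  fixes t s :: "'n \<Rightarrow> real"
  assumes "\<And>i. t i \<in> {-1, 1}" and "\<And>i. s i \<in> {-1, 1}"
  shows "case_sum t s k \<noteq> 0"
proof (cases k)
  case (Inl i)
  then show ?thesis using assms(1)[of i] by auto
next
  case (Inr i)
  then show ?thesis using assms(2)[of i] by auto
qed

lemma heis_metric_flat_metric:
  assumes "heis_metric t s g" "v \<in> heis_H q" "w \<in> heis_H q"
  shows "g q v w = flat_metric (case_sum t s) (horiz v) (horiz w)"
  using heis_metric_unique[OF assms(1) heis_metric_exists assms(2,3)]
  by (simp add: flat_metric_def sum_UNIV_sum)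

lemma Sp_omega_iff: "\<sigma> \<in> Sp_omega \<longleftrightarrow> (\<forall>u v. sympl (\<sigma> *v u) (\<sigma> *v v) = sympl u v)"
  by (simp add: Sp_omega_def heis_omega_sympl)

lemma O_metric_iff:
  assumes "heis_metric t s g"
  shows "\<sigma> \<in> O_metric g \<longleftrightarrow>
    (\<forall>u v. flat_metric (case_sum t s) (\<sigma> *v u) (\<sigma> *v v) = flat_metric (case_sum t s) u v)"
  by (simp add: O_metric_def heis_metric_flat_metric[OF assms] heis_frame_in_heis_H)

section \<open>Powers of a 2-form on a symplectic frame\<close>

text \<open>The Gram matrix of a symplectic form on a frame ordered as \<open>X\<^sub>1, Y\<^sub>1, X\<^sub>2, Y\<^sub>2, \<dots>\<close> (numbered
  from 0): the frame falls into blocks \<open>{2i, 2i + 1}\<close>, and only the two members of one block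
  pair to something nonzero.\<close>

definition std_pairing :: "nat \<Rightarrow> nat \<Rightarrow> real" where
  "std_pairing a b = (if a div 2 = b div 2 then real (b mod 2) - real (a mod 2) else 0)"

abbreviation std_product :: "nat \<Rightarrow> (nat \<Rightarrow> nat) \<Rightarrow> real" where
  "std_product k \<pi> \<equiv> (\<Prod>i<k. std_pairing (\<pi> (2 * i)) (\<pi> (2 * i + 1)))"

lemma std_pairing_consecutive [simp]: "std_pairing (2 * i) (Suc (2 * i)) = 1"
  by (simp add: std_pairing_def)

text \<open>Exchanging two whole blocks is a product of two transpositions, hence even, and it is a
  symmetry of the Gram matrix.\<close>

lemma block_swap:
  fixes j k :: nat
  defines "\<beta> \<equiv> Transposition.transpose (2 * k) (2 * j) \<circ> Transposition.transpose (2 * k + 1) (2 * j + 1)"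
  shows "sign \<beta> = 1" and "std_pairing (\<beta> a) (\<beta> b) = std_pairing a b"
    and "\<beta> (2 * j) = 2 * k" and "\<beta> (2 * j + 1) = 2 * k + 1"
    and "k \<le> j \<Longrightarrow> j < N \<Longrightarrow> \<beta> permutes {2 * k..<2 * N}"
proof -
  show "sign \<beta> = 1"
    unfolding \<beta>_def by (subst sign_compose) (auto simp: sign_swap_id permutation_swap_id)
  have even: "\<beta> (2 * i) = 2 * Transposition.transpose k j i"
    and odd: "\<beta> (Suc (2 * i)) = Suc (2 * Transposition.transpose k j i)" for i
    by (simp_all add: \<beta>_def Transposition.transpose_def Suc_double_not_eq_double
        double_not_eq_Suc_double)
  have div_mod: "\<beta> x div 2 = Transposition.transpose k j (x div 2)" "\<beta> x mod 2 = x mod 2" for x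
    by (cases "even x"; elim evenE oddE; simp add: even odd)+
  show "std_pairing (\<beta> a) (\<beta> b) = std_pairing a b"
    using transpose_involutory[of k j] unfolding std_pairing_def div_mod by metis
  show "\<beta> (2 * j) = 2 * k" "\<beta> (2 * j + 1) = 2 * k + 1"
    using even[of j] odd[of j] by simp_all
  show "\<beta> permutes {2 * k..<2 * N}" if "k \<le> j" "j < N"
    unfolding \<beta>_def using that by (intro permutes_compose permutes_swap_id) auto
qed

text \<open>If the product is nonzero, then \<open>\<pi>\<close> permutes the blocks and possibly flips some of them. The
  permutation of the blocks is even, and every flip changes both the sign of \<open>\<pi>\<close> and the sign of
  one factor. The proof undoes this one block at a time; \<open>k\<close> counts the blocks that are already
  pointwise fixed.\<close>

lemma sign_std_product_nonneg:
  assumes "\<pi> permutes {2 * k..<2 * N}" "k \<le> N"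
  shows "0 \<le> of_int (sign \<pi>) * std_product N \<pi>"
  using assms
proof (induction "N - k" arbitrary: k \<pi>)
  case 0
  then have "\<pi> = id" by simp
  then show ?case by simp
next
  case (Suc m)
  then have k: "k < N" "m = N - Suc k" by auto
  let ?T = "\<lambda>\<pi>. of_int (sign \<pi>) * std_product N \<pi>"
  show ?case
  proof (cases "std_pairing (\<pi> (2 * k)) (\<pi> (2 * k + 1)) = 0")
    case True
    then have "std_product N \<pi> = 0"
      using k by (intro prod_zero) auto
    then show ?thesis
      by (simp only: mult_zero_right order_refl)
  next
    case False
    define j where "j = \<pi> (2 * k) div 2"
    have im: "\<pi> (2 * k) \<in> {2 * k..<2 * N}"
      using permutes_in_image[OF Suc.prems(1), of "2 * k"] k by auto
    then have j: "k \<le> j" "j < N"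
      unfolding j_def by auto
    define \<beta> where "\<beta> = Transposition.transpose (2 * k) (2 * j) \<circ> Transposition.transpose (2 * k + 1) (2 * j + 1)"
    note \<beta> = block_swap[of k j, folded \<beta>_def]
    define \<rho> where "\<rho> = \<beta> \<circ> \<pi>"
    have \<beta>p: "\<beta> permutes {2 * k..<2 * N}"
      by (rule \<beta>(5)[OF j])
    have \<rho>p: "\<rho> permutes {2 * k..<2 * N}"
      unfolding \<rho>_def by (rule permutes_compose[OF Suc.prems(1) \<beta>p])
    have "sign \<rho> = sign \<pi>"
      unfolding \<rho>_def using Suc.prems(1) \<beta>p \<beta>(1)
      by (subst sign_compose) (auto intro: permutation_permutes[THEN iffD2])
    then have T: "?T \<rho> = ?T \<pi>"
      by (simp add: \<rho>_def \<beta>(2))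
    have "\<pi> (2 * k) = 2 * j \<and> \<pi> (2 * k + 1) = 2 * j + 1 \<or>
        \<pi> (2 * k) = 2 * j + 1 \<and> \<pi> (2 * k + 1) = 2 * j"
    proof -
      have "\<pi> (2 * k) div 2 = \<pi> (2 * k + 1) div 2" "\<pi> (2 * k) mod 2 \<noteq> \<pi> (2 * k + 1) mod 2"
        using False by (auto simp: std_pairing_def split: if_splits)
      moreover have "a = 2 * (a div 2) \<and> b = 2 * (a div 2) + 1 \<or>
          a = 2 * (a div 2) + 1 \<and> b = 2 * (a div 2)"
        if "a div 2 = b div 2" "a mod 2 \<noteq> b mod 2" for a b :: nat
        using that
        by (cases "even a"; cases "even b") (auto elim!: evenE oddE simp: mod_2_eq_odd)
      ultimately show ?thesis
        unfolding j_def by blast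
    qed
    then consider (id) "\<rho> (2 * k) = 2 * k" "\<rho> (2 * k + 1) = 2 * k + 1"
      | (swap) "\<rho> (2 * k) = 2 * k + 1" "\<rho> (2 * k + 1) = 2 * k"
      using \<beta>(3,4) by (auto simp: \<rho>_def)
    then have "0 \<le> ?T \<rho>"
    proof cases
      case id
      have "\<rho> permutes {2 * Suc k..<2 * N}"
      proof (rule permutes_superset[OF \<rho>p])
        fix x assume "x \<in> {2 * k..<2 * N} - {2 * Suc k..<2 * N}"
        then have "x = 2 * k \<or> x = 2 * k + 1" by auto
        then show "\<rho> x = x" using id by auto
      qed
      then show ?thesis
        using Suc.hyps(1)[OF k(2), of \<rho>] k by simp
    next
      case swap
      define \<tau> where "\<tau> = Transposition.transpose (2 * k) (2 * k + 1) \<circ> \<rho>"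
      have \<tau>0: "Transposition.transpose (2 * k) (2 * k + 1) permutes {2 * k..<2 * N}"
        using k by (intro permutes_swap_id) auto
      have \<tau>p: "\<tau> permutes {2 * k..<2 * N}"
        unfolding \<tau>_def by (rule permutes_compose[OF \<rho>p \<tau>0])
      have "\<tau> permutes {2 * Suc k..<2 * N}"
      proof (rule permutes_superset[OF \<tau>p])
        fix x assume "x \<in> {2 * k..<2 * N} - {2 * Suc k..<2 * N}"
        then have "x = 2 * k \<or> x = 2 * k + 1" by auto
        then show "\<tau> x = x" using swap by (auto simp: \<tau>_def)
      qed
      then have "0 \<le> ?T \<tau>"
        using Suc.hyps(1)[OF k(2), of \<tau>] k by simp
      moreover have "sign \<tau> = - sign \<rho>"
        unfolding \<tau>_def using \<rho>p
        by (subst sign_compose)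
          (auto simp: sign_swap_id permutation_swap_id intro: permutation_permutes[THEN iffD2])
      moreover have "std_product N \<tau> = - std_product N \<rho>"
      proof -
        have split: "std_product N f
            = std_pairing (f (2 * k)) (f (2 * k + 1))
              * (\<Prod>i\<in>{..<N} - {k}. std_pairing (f (2 * i)) (f (2 * i + 1)))" for f
          using k by (intro prod.remove) auto
        have fixed: "\<tau> x = \<rho> x" if "x \<noteq> 2 * k" "x \<noteq> 2 * k + 1" for x
        proof -
          have "\<rho> x \<noteq> \<rho> (2 * k)" "\<rho> x \<noteq> \<rho> (2 * k + 1)"
            using that permutes_inj[OF \<rho>p] by (simp_all add: inj_eq)
          then show ?thesis
            using swap by (simp add: \<tau>_def Transposition.transpose_def)
        qed
        have "(\<Prod>i\<in>{..<N} - {k}. std_pairing (\<tau> (2 * i)) (\<tau> (2 * i + 1)))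
            = (\<Prod>i\<in>{..<N} - {k}. std_pairing (\<rho> (2 * i)) (\<rho> (2 * i + 1)))"
        proof (rule prod.cong[OF refl])
          fix i assume "i \<in> {..<N} - {k}"
          then have "\<tau> (2 * i) = \<rho> (2 * i)" "\<tau> (2 * i + 1) = \<rho> (2 * i + 1)"
            by (auto intro!: fixed simp: double_not_eq_Suc_double Suc_double_not_eq_double)
          then show "std_pairing (\<tau> (2 * i)) (\<tau> (2 * i + 1))
              = std_pairing (\<rho> (2 * i)) (\<rho> (2 * i + 1))"
            by simp
        qed
        moreover have "std_pairing (\<tau> (2 * k)) (\<tau> (2 * k + 1))
            = - std_pairing (\<rho> (2 * k)) (\<rho> (2 * k + 1))"
          using swap by (simp add: \<tau>_def std_pairing_def)
        ultimately show ?thesis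
          by (simp only: split[of \<tau>] split[of \<rho>] mult_minus_left)
      qed
      ultimately show ?thesis by simp
    qed
    then show ?thesis
      using T by simp
  qed
qed

text \<open>The inner permutation of an iterated wedge product acts on the arguments from position \<open>off\<close>
  on; this is that permutation as one of all arguments.\<close>

lemma shift_permutation:
  fixes off n :: nat
  assumes "\<pi> permutes {..<n}"
  defines "\<rho> \<equiv> map_permutation {..<n} ((+) off) \<pi>"
  shows "\<rho> permutes {..<off + n}" and "sign \<rho> = sign \<pi>"
    and "\<rho> (off + i) = off + \<pi> i" and "i < off \<Longrightarrow> \<rho> i = i"
proof -
  have *: "\<rho> permutes {off..<off + n}"
    unfolding \<rho>_def
    by (rule map_permutation_permutes[OF _ assms(1)])
       (auto simp: bij_betw_def lessThan_atLeast0 image_add_atLeastLessThan')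
  then show "\<rho> permutes {..<off + n}"
    by (rule permutes_subset) auto
  show "sign \<rho> = sign \<pi>"
    unfolding \<rho>_def by (rule sign_map_permutation) (use assms in auto)
  show "\<rho> i = i" if "i < off"
    using * that by (auto simp: permutes_def)
  show "\<rho> (off + i) = off + \<pi> i"
  proof (cases "i < n")
    case True
    then show ?thesis
      unfolding \<rho>_def by (subst map_permutation_apply) auto
  next
    case False
    then have "\<rho> (off + i) = off + i" "\<pi> i = i"
      using * assms(1) by (auto simp: permutes_def)
    then show ?thesis by simp
  qed
qed

text \<open>All terms in the full expansion of the power have the same sign, so nothing cancels and the
  power is positive on the frame. For the induction on \<open>m\<close>, the statement covers a partially
  expanded power: \<open>\<sigma>\<close> collects the permutations chosen so far, and the product of pairings
  belongs to the \<open>N - m\<close> factors already split off.\<close>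

lemma wedge_power2_symplectic_frame:
  fixes w :: "nat \<Rightarrow> 'v"
  assumes w: "\<And>a b. a < 2 * N \<Longrightarrow> b < 2 * N \<Longrightarrow> \<beta> (w a) (w b) = std_pairing a b"
    and "m \<le> N"
  shows "\<sigma> permutes {..<2 * N} \<Longrightarrow>
      0 \<le> of_int (sign \<sigma>) * std_product (N - m) \<sigma>
           * wedge_power2 (form2 \<beta>) m (\<lambda>i. w (\<sigma> (2 * (N - m) + i)))"
    and "0 < wedge_power2 (form2 \<beta>) m (\<lambda>i. w (2 * (N - m) + i))"
proof -
  define Q where "Q m \<sigma> = of_int (sign \<sigma>) * std_product (N - m) \<sigma>
           * wedge_power2 (form2 \<beta>) m (\<lambda>i. w (\<sigma> (2 * (N - m) + i)))" for m \<sigma>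
  have Q_id: "Q m id = wedge_power2 (form2 \<beta>) m (\<lambda>i. w (2 * (N - m) + i))" for m
    by (simp add: Q_def)
  have "(\<forall>\<sigma>. \<sigma> permutes {..<2 * N} \<longrightarrow> 0 \<le> Q m \<sigma>) \<and> 0 < Q m id"
    using \<open>m \<le> N\<close>
  proof (induction m)
    case 0
    then show ?case
      using sign_std_product_nonneg[of _ 0 N] by (auto simp: Q_def lessThan_atLeast0)
  next
    case (Suc m)
    then have IH: "0 \<le> Q m \<sigma>" if "\<sigma> permutes {..<2 * N}" for \<sigma>
      using that by simp
    have IH_id: "0 < Q m id"
      using Suc.IH Suc.prems Suc_leD by blast
    define off where "off = 2 * (N - Suc m)"
    have off: "2 * (N - m) = off + 2" "N - m = Suc (N - Suc m)" "off + (2 + 2 * m) = 2 * N"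
      using Suc.prems by (auto simp: off_def)
    define S where "S \<pi> = map_permutation {..<2 + 2 * m} ((+) off) \<pi>" for \<pi>
    let ?P = "{\<pi>. \<pi> permutes {..<2 + 2 * m}}"
    \<comment> \<open>Absorbing the permutation of the wedge product into the argument turns every summand
      into an instance of the induction hypothesis.\<close>
    have expand: "Q (Suc m) \<sigma> = (\<Sum>\<pi>\<in>?P. Q m (\<sigma> \<circ> S \<pi>)) / (2 * fact (2 * m))"
      if \<sigma>: "\<sigma> permutes {..<2 * N}" for \<sigma>
    proof -
      let ?v = "\<lambda>i. w (\<sigma> (off + i))"
      let ?c = "of_int (sign \<sigma>) * std_product (N - Suc m) \<sigma>"
      have summand: "?c * (of_int (sign \<pi>) * form2 \<beta> (\<lambda>i. ?v (\<pi> i))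
            * wedge_power2 (form2 \<beta>) m (\<lambda>i. ?v (\<pi> (2 + i)))) = Q m (\<sigma> \<circ> S \<pi>)"
        if "\<pi> \<in> ?P" for \<pi>
      proof -
        have \<pi>: "\<pi> permutes {..<2 + 2 * m}"
          using that by simp
        note S = shift_permutation[OF \<pi>, where off = off, folded S_def, unfolded off(3)]
        have v: "?v (\<pi> i) = w ((\<sigma> \<circ> S \<pi>) (off + i))" for i
          by (simp add: S(3))
        have p: "std_product (N - Suc m) \<sigma> = std_product (N - Suc m) (\<sigma> \<circ> S \<pi>)"
        proof (rule prod.cong[OF refl])
          fix i assume "i \<in> {..<N - Suc m}"
          then have "2 * i < off" "2 * i + 1 < off"
            by (auto simp: off_def)
          then show "std_pairing (\<sigma> (2 * i)) (\<sigma> (2 * i + 1))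
              = std_pairing ((\<sigma> \<circ> S \<pi>) (2 * i)) ((\<sigma> \<circ> S \<pi>) (2 * i + 1))"
            using S(4)[of "2 * i"] S(4)[of "2 * i + 1"] by simp
        qed
        have "\<sigma> \<circ> S \<pi> permutes {..<2 * N}"
          by (rule permutes_compose[OF S(1) \<sigma>])
        then have "(\<sigma> \<circ> S \<pi>) off < 2 * N" "(\<sigma> \<circ> S \<pi>) (off + 1) < 2 * N"
          using permutes_in_image[of "\<sigma> \<circ> S \<pi>" "{..<2 * N}"] off(3) by auto
        from w[OF this] have b: "form2 \<beta> (\<lambda>i. w ((\<sigma> \<circ> S \<pi>) (off + i)))
            = std_pairing ((\<sigma> \<circ> S \<pi>) off) ((\<sigma> \<circ> S \<pi>) (off + 1))"
          by (simp add: form2_def del: comp_apply)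
        have s: "sign (\<sigma> \<circ> S \<pi>) = sign \<sigma> * sign \<pi>"
          using S(1) \<sigma> by (subst sign_compose)
            (auto simp: S(2) intro: permutation_permutes[THEN iffD2])
        have args: "(\<lambda>i. w ((\<sigma> \<circ> S \<pi>) (2 * (N - m) + i))) = (\<lambda>i. w ((\<sigma> \<circ> S \<pi>) (off + (2 + i))))"
          by (simp only: off(1) add.assoc)
        have factor: "std_product (N - m) (\<sigma> \<circ> S \<pi>) = std_product (N - Suc m) (\<sigma> \<circ> S \<pi>)
            * std_pairing ((\<sigma> \<circ> S \<pi>) off) ((\<sigma> \<circ> S \<pi>) (off + 1))"
          by (simp only: off(2) prod.lessThan_Suc off_def)
        show ?thesis
          unfolding v unfolding b p Q_def args factor s
          by (simp only: of_int_mult mult_ac)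
      qed
      have "Q (Suc m) \<sigma> = ?c * wedge 2 (2 * m) (form2 \<beta>) (wedge_power2 (form2 \<beta>) m) ?v"
        by (simp add: Q_def off_def)
      also have "\<dots> = (\<Sum>\<pi>\<in>?P. ?c * (of_int (sign \<pi>) * form2 \<beta> (\<lambda>i. ?v (\<pi> i))
            * wedge_power2 (form2 \<beta>) m (\<lambda>i. ?v (\<pi> (2 + i))))) / (2 * fact (2 * m))"
        by (simp add: wedge_def sum_distrib_left)
      also have "\<dots> = (\<Sum>\<pi>\<in>?P. Q m (\<sigma> \<circ> S \<pi>)) / (2 * fact (2 * m))"
        by (intro arg_cong2[where f = "(/)"] sum.cong refl summand)
      finally show ?thesis .
    qed
    have nonneg: "0 \<le> Q m (\<sigma> \<circ> S \<pi>)" if "\<sigma> permutes {..<2 * N}" "\<pi> \<in> ?P" for \<sigma> \<pi>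
    proof -
      have "\<pi> permutes {..<2 + 2 * m}"
        using that by simp
      from shift_permutation(1)[OF this, where off = off] have "S \<pi> permutes {..<2 * N}"
        unfolding off(3) S_def .
      then show ?thesis
        by (intro IH permutes_compose[OF _ that(1)])
    qed
    have "S id = id"
      unfolding S_def by (rule map_permutation_id') simp
    then have "0 < Q m (id \<circ> S id)"
      using IH_id by simp
    then have "0 < (\<Sum>\<pi>\<in>?P. Q m (id \<circ> S \<pi>))"
      using nonneg[of id]
      by (intro sum_pos2[where i = id]) (auto simp: finite_permutations permutes_id)
    then have "0 < Q (Suc m) id"
      unfolding expand[OF permutes_id] by (rule divide_pos_pos) simp
    moreover have "0 \<le> Q (Suc m) \<sigma>" if "\<sigma> permutes {..<2 * N}" for \<sigma>
      unfolding expand[OF that]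
      by (intro divide_nonneg_pos sum_nonneg nonneg that) simp_all
    ultimately show ?case by blast
  qed
  then have Q: "0 < Q m id" and "\<sigma> permutes {..<2 * N} \<Longrightarrow> 0 \<le> Q m \<sigma>"
    by blast+
  then show "\<sigma> permutes {..<2 * N} \<Longrightarrow>
      0 \<le> of_int (sign \<sigma>) * std_product (N - m) \<sigma>
           * wedge_power2 (form2 \<beta>) m (\<lambda>i. w (\<sigma> (2 * (N - m) + i)))"
    by (simp only: Q_def)
  show "0 < wedge_power2 (form2 \<beta>) m (\<lambda>i. w (2 * (N - m) + i))"
    using Q unfolding Q_id .
qed

text \<open>A permutation that moves the last vector puts another frame vector into \<open>\<theta>\<close>, which kills it;
  what remains is the expansion of the power on the first \<open>2N\<close> vectors.\<close>

lemma wedge_power2_form1_symplectic_frame: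
  fixes w :: "nat \<Rightarrow> 'v"
  assumes w: "\<And>a b. a < 2 * N \<Longrightarrow> b < 2 * N \<Longrightarrow> \<beta> (w a) (w b) = std_pairing a b"
    and \<theta>: "\<And>a. a < 2 * N \<Longrightarrow> \<theta> (w a) = 0" "\<theta> (w (2 * N)) = 1"
  shows "0 < wedge (2 * N) 1 (wedge_power2 (form2 \<beta>) N) (form1 \<theta>) w"
proof -
  let ?P = "{\<pi>. \<pi> permutes {..<2 * N + 1}}"
  let ?t = "\<lambda>\<pi>. of_int (sign \<pi>) * wedge_power2 (form2 \<beta>) N (\<lambda>i. w (\<pi> i))
      * form1 \<theta> (\<lambda>i. w (\<pi> (2 * N + i)))"
  have "0 \<le> ?t \<pi>" if "\<pi> \<in> ?P" for \<pi>
  proof (cases "\<pi> (2 * N) = 2 * N")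
    case True
    have "\<pi> permutes {..<2 * N + 1}"
      using that by simp
    then have "\<pi> permutes {..<2 * N}"
    proof (rule permutes_superset)
      fix x assume "x \<in> {..<2 * N + 1} - {..<2 * N}"
      then have "x = 2 * N" by auto
      then show "\<pi> x = x" using True by simp
    qed
    from wedge_power2_symplectic_frame(1)[of N \<beta> w N, OF w _ this] show ?thesis
      using True \<theta>(2) by (simp add: form1_def)
  next
    case False
    then have "\<pi> (2 * N) < 2 * N"
      using permutes_in_image[of \<pi> "{..<2 * N + 1}" "2 * N"] that by auto
    then show ?thesis
      by (simp add: form1_def \<theta>(1))
  qed
  moreover have "0 < ?t id"
    using wedge_power2_symplectic_frame(2)[of N \<beta> w N, OF w] \<theta>(2) by (simp add: form1_def)
  ultimately have "0 < (\<Sum>\<pi>\<in>?P. ?t \<pi>)"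
    by (intro sum_pos2[where i = id]) (auto simp: finite_permutations permutes_id)
  then show ?thesis
    by (simp add: wedge_def)
qed

lemma wedge_power2_scale:
  assumes "\<And>i j. \<beta>' (v' i) (v' j) = c * \<beta> (v i) (v j)"
  shows "wedge_power2 (form2 \<beta>') m v' = c ^ m * wedge_power2 (form2 \<beta>) m v"
  using assms
proof (induction m arbitrary: v v')
  case (Suc m)
  have "wedge_power2 (form2 \<beta>') m (\<lambda>i. v' (\<pi> (2 + i)))
      = c ^ m * wedge_power2 (form2 \<beta>) m (\<lambda>i. v (\<pi> (2 + i)))" for \<pi>
    by (rule Suc.IH) (rule Suc.prems)
  moreover have "form2 \<beta>' (\<lambda>i. v' (\<pi> i)) = c * form2 \<beta> (\<lambda>i. v (\<pi> i))" for \<pi>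
    by (simp add: form2_def Suc.prems)
  ultimately show ?case
    by (simp only: wedge_power2.simps wedge_def power_Suc times_divide_eq_right
        sum_distrib_left mult_ac)
qed simp

lemma wedge_power2_form1_scale:
  assumes "\<And>i j. \<beta>' (v' i) (v' j) = c * \<beta> (v i) (v j)" and "\<And>i. \<theta>' (v' i) = c * \<theta> (v i)"
  shows "wedge k l (wedge_power2 (form2 \<beta>') m) (form1 \<theta>') v'
    = c ^ Suc m * wedge k l (wedge_power2 (form2 \<beta>) m) (form1 \<theta>) v"
proof -
  have "wedge_power2 (form2 \<beta>') m (\<lambda>i. v' (\<pi> i)) = c ^ m * wedge_power2 (form2 \<beta>) m (\<lambda>i. v (\<pi> i))"
    for \<pi>
    by (rule wedge_power2_scale) (rule assms)
  then show ?thesis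
    by (simp add: wedge_def form1_def assms(2) sum_distrib_left mult_ac)
qed

section \<open>The standard frame of the Heisenberg group\<close>

lemma heis_H_form_omega: "heis_H_form q = wedge_power2 (form2 heis_omega) CARD('n)"
  for q :: "'n::finite heis"
  by (simp add: heis_H_form_def exterior_derivative_heis_alpha[abs_def])

text \<open>Without a positive frame the condition that a map preserves orientation would be void.
  The frame is \<open>X\<^sub>1, Y\<^sub>1, \<dots>, X\<^sub>n, Y\<^sub>n\<close> followed by the central direction.\<close>

lemma positive_frame:
  obtains w :: "nat \<Rightarrow> 'n::finite heis"
  where "\<And>i. i < 2 * CARD('n) \<Longrightarrow> w i \<in> heis_H q"
    and "0 < heis_H_form q w" and "0 < heis_volume_form q w"
proof -
  let ?N = "CARD('n)"
  obtain e :: "nat \<Rightarrow> 'n" where e: "bij_betw e {..<?N} UNIV"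
    using ex_bij_betw_nat_finite[of "UNIV :: 'n set"] by (auto simp: lessThan_atLeast0)
  define w where "w i = (if i < 2 * ?N
      then (if even i then X_field (e (i div 2)) q else Y_field (e (i div 2)) q)
      else heis_of 0 1)" for i
  have H: "w i \<in> heis_H q" if "i < 2 * ?N" for i
    using that by (simp add: w_def frame_in_heis_H)
  have axis_component: "axis k (1 :: real) $ l = (if l = k then 1 else 0)" for k l :: "'n + 'n"
    by (simp add: axis_def)
  have \<omega>: "heis_omega (w a) (w b) = std_pairing a b" if "a < 2 * ?N" "b < 2 * ?N" for a b
  proof -
    have "e (a div 2) = e (b div 2) \<longleftrightarrow> a div 2 = b div 2"
      "e (b div 2) = e (a div 2) \<longleftrightarrow> a div 2 = b div 2"
      using bij_betw_imp_inj_on[OF e] that by (auto simp: inj_on_def)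
    then show ?thesis
      using that by (cases "even a"; cases "even b")
        (simp_all add: w_def heis_omega_sympl std_pairing_def axis_component mod_2_eq_odd)
  qed
  have 1: "heis_alpha q (w a) = 0" if "a < 2 * ?N" for a
    using H[OF that] by (simp add: heis_H_iff)
  have 2: "heis_alpha q (w (2 * ?N)) = 1"
    by (simp add: w_def heis_alpha_sympl sympl_simps)
  show ?thesis
  proof (rule that[of w])
    show "0 < heis_H_form q w"
      using wedge_power2_symplectic_frame(2)[of ?N heis_omega w ?N, OF \<omega>]
      by (simp add: heis_H_form_omega)
    show "0 < heis_volume_form q w"
      using wedge_power2_form1_symplectic_frame[of ?N heis_omega w "heis_alpha q", OF \<omega> 1 2]
      by (simp add: heis_volume_form_def heis_H_form_omega)
  qed (rule H)
qed

text \<open>The two exponents differ by one. So if both forms are multiplied by positive numbers, then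
  \<open>c\<close> itself is positive.\<close>

lemma orientation_forms_scale:
  fixes q q' :: "'n::finite heis"
  assumes "\<And>v w. heis_omega (A v) (A w) = c * heis_omega v w"
    and "\<And>v. heis_alpha q' (A v) = c * heis_alpha q v"
  shows "heis_H_form q' (\<lambda>i. A (v i)) = c ^ CARD('n) * heis_H_form q v"
    and "heis_volume_form q' (\<lambda>i. A (v i)) = c ^ Suc CARD('n) * heis_volume_form q v"
  unfolding heis_volume_form_def heis_H_form_omega
  by (rule wedge_power2_scale wedge_power2_form1_scale; rule assms)+

section \<open>The semidirect product\<close>

lemma linear_f_sigma: "linear (f_sigma \<sigma>)"
  by (rule linearI) (simp_all add: heis_eq_iff matrix_vector_right_distrib
      matrix_vector_mult_scaleR)

lemma f_sigma_mult: "f_sigma (\<sigma> ** \<tau>) p = f_sigma \<sigma> (f_sigma \<tau> p)"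
  by (simp add: heis_eq_iff matrix_vector_mul_assoc)

lemma f_sigma_one [simp]: "f_sigma (mat 1) p = p"
  by (simp add: heis_eq_iff)

lemma f_sigma_heis_mult:
  assumes "\<sigma> \<in> Sp_omega"
  shows "f_sigma \<sigma> (heis_mult p q) = heis_mult (f_sigma \<sigma> p) (f_sigma \<sigma> q)"
  using assms by (simp add: heis_eq_iff Sp_omega_iff matrix_vector_right_distrib)

lemma heis_mult_assoc: "heis_mult (heis_mult p q) r = heis_mult p (heis_mult q r)"
  by (simp add: heis_eq_iff sympl_simps field_simps)

lemma heis_mult_zero [simp]: "heis_mult 0 p = p" "heis_mult p 0 = p"
  by (simp_all add: heis_eq_iff sympl_simps)

lemma heis_mult_uminus: "heis_mult (- p) p = 0" "heis_mult p (- p) = 0"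
proof -
  have "sympl u u = 0" for u :: "real ^ ('a + 'a)"
    using sympl_commute[of u u] by simp
  then show "heis_mult (- p) p = 0" "heis_mult p (- p) = 0"
    using linear_neg[OF linear_horiz, of p] linear_neg[OF linear_zc, of p]
    by (simp_all add: heis_eq_iff bilinear_lneg[OF sympl_bilinear] bilinear_rneg[OF sympl_bilinear])
qed

lemma group_heis_group: "group heis_group"
proof (rule groupI)
  show "\<exists>y\<in>carrier heis_group. y \<otimes>\<^bsub>heis_group\<^esub> x = \<one>\<^bsub>heis_group\<^esub>" for x :: "'a heis"
    using heis_mult_uminus(1)[of x] by (simp add: heis_group_def del: split_paired_Ex) blast
qed (simp_all add: heis_group_def heis_mult_assoc)

lemma group_semidirect:
  assumes "group N" "group K"
    and hom: "\<And>k. k \<in> carrier K \<Longrightarrow> \<phi> k \<in> hom N N"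
    and mult: "\<And>k l a. \<lbrakk>k \<in> carrier K; l \<in> carrier K; a \<in> carrier N\<rbrakk>
      \<Longrightarrow> \<phi> (k \<otimes>\<^bsub>K\<^esub> l) a = \<phi> k (\<phi> l a)"
    and one: "\<And>a. a \<in> carrier N \<Longrightarrow> \<phi> \<one>\<^bsub>K\<^esub> a = a"
  shows "group (semidirect N K \<phi>)"
proof -
  interpret N: group N by fact
  interpret K: group K by fact
  have closed: "\<phi> k a \<in> carrier N" if "k \<in> carrier K" "a \<in> carrier N" for k a
    using hom[OF that(1)] that(2) by (rule hom_in_carrier)
  have dist: "\<phi> k (a \<otimes>\<^bsub>N\<^esub> b) = \<phi> k a \<otimes>\<^bsub>N\<^esub> \<phi> k b"
    if "k \<in> carrier K" "a \<in> carrier N" "b \<in> carrier N" for k a b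
    using hom[OF that(1)] that(2,3) by (rule hom_mult)
  have unit: "\<phi> k \<one>\<^bsub>N\<^esub> = \<one>\<^bsub>N\<^esub>" if "k \<in> carrier K" for k
    using hom_one[OF hom[OF that]] N.is_group by blast
  show ?thesis
  proof (rule groupI)
    fix x assume "x \<in> carrier (semidirect N K \<phi>)"
    then obtain a k where x: "x = (a, k)" "a \<in> carrier N" "k \<in> carrier K"
      by (auto simp: semidirect_def)
    let ?y = "(\<phi> (inv\<^bsub>K\<^esub> k) (inv\<^bsub>N\<^esub> a), inv\<^bsub>K\<^esub> k)"
    have "\<phi> (inv\<^bsub>K\<^esub> k) (inv\<^bsub>N\<^esub> a) \<otimes>\<^bsub>N\<^esub> \<phi> (inv\<^bsub>K\<^esub> k) a = \<one>\<^bsub>N\<^esub>"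
      using x by (simp flip: dist add: unit)
    then have "?y \<in> carrier (semidirect N K \<phi>)"
      "?y \<otimes>\<^bsub>semidirect N K \<phi>\<^esub> x = \<one>\<^bsub>semidirect N K \<phi>\<^esub>"
      using x by (simp_all add: semidirect_def closed)
    then show "\<exists>y\<in>carrier (semidirect N K \<phi>).
        y \<otimes>\<^bsub>semidirect N K \<phi>\<^esub> x = \<one>\<^bsub>semidirect N K \<phi>\<^esub>"
      by blast
  qed (auto simp: semidirect_def closed dist mult one N.m_assoc K.m_assoc)
qed

text \<open>A symplectic matrix is injective because the form is nondegenerate.\<close>

lemma Sp_omega_inverse:
  assumes "\<sigma> \<in> Sp_omega"
  obtains \<tau> where "\<tau> ** \<sigma> = mat 1" "\<sigma> ** \<tau> = mat 1"
proof -
  have "inj ((*v) \<sigma>)"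
  proof (rule linear_injective_0[THEN iffD2], rule matrix_vector_mul_linear, intro allI impI)
    fix u assume "\<sigma> *v u = 0"
    then have "sympl u v = 0" for v
      using assms unfolding Sp_omega_iff by (metis bilinear_lzero[OF sympl_bilinear])
    then show "u = 0"
      by (rule sympl_nondegenerate)
  qed
  then obtain \<tau> where "\<tau> ** \<sigma> = mat 1"
    using matrix_left_invertible_injective by blast
  then show ?thesis
    using that matrix_left_right_inverse by blast
qed

lemma group_SpO_group:
  assumes g: "heis_metric t s g"
  shows "group (SpO_group g)"
proof (rule groupI)
  fix \<sigma> assume "\<sigma> \<in> carrier (SpO_group g)"
  then have \<sigma>: "\<sigma> \<in> Sp_omega" "\<sigma> \<in> O_metric g"
    by (auto simp: SpO_group_def)
  obtain \<tau> where \<tau>: "\<tau> ** \<sigma> = mat 1" "\<sigma> ** \<tau> = mat 1"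
    using Sp_omega_inverse[OF \<sigma>(1)] .
  have "\<sigma> *v (\<tau> *v u) = u" for u
    using \<tau>(2) by (simp add: matrix_vector_mul_assoc)
  then have "\<tau> \<in> Sp_omega" "\<tau> \<in> O_metric g"
    using \<sigma> unfolding Sp_omega_iff O_metric_iff[OF g] by metis+
  then show "\<exists>\<tau>\<in>carrier (SpO_group g). \<tau> \<otimes>\<^bsub>SpO_group g\<^esub> \<sigma> = \<one>\<^bsub>SpO_group g\<^esub>"
    using \<tau>(1) by (auto simp: SpO_group_def)
qed (auto simp: SpO_group_def Sp_omega_iff O_metric_iff[OF g] matrix_mul_assoc
    simp flip: matrix_vector_mul_assoc)

lemma group_heis_semidirect:
  assumes g: "heis_metric t s g"
  shows "group (semidirect heis_group (SpO_group g) f_sigma)"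
proof (rule group_semidirect[OF group_heis_group group_SpO_group[OF g]])
  show "f_sigma \<sigma> \<in> hom heis_group heis_group" if "\<sigma> \<in> carrier (SpO_group g)" for \<sigma>
    using that by (auto simp: hom_def heis_group_def SpO_group_def f_sigma_heis_mult)
qed (simp_all add: SpO_group_def f_sigma_mult)

section \<open>Heisenberg motions\<close>

definition heis_motion ::
  "'n::finite heis \<Rightarrow> real ^ ('n + 'n) ^ ('n + 'n) \<Rightarrow> 'n heis \<Rightarrow> 'n heis" where
  "heis_motion p \<sigma> = heis_mult p \<circ> f_sigma \<sigma>"

text \<open>The group law is affine in its second argument and \<open>f_sigma\<close> is linear. Hence a motion is an
  affine map, which makes its smoothness immediate, and this is its linear part.\<close>

definition heis_motion_linear ::
  "'n::finite heis \<Rightarrow> real ^ ('n + 'n) ^ ('n + 'n) \<Rightarrow> 'n heis \<Rightarrow> 'n heis" where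
  "heis_motion_linear p \<sigma> v =
     heis_of (\<sigma> *v horiz v) (zc v - sympl (horiz p) (\<sigma> *v horiz v) / 2)"

lemma heis_motion_affine: "heis_motion p \<sigma> q = p + heis_motion_linear p \<sigma> q"
  by (simp add: heis_motion_def heis_eq_iff heis_motion_linear_def)

lemma linear_heis_motion_linear: "linear (heis_motion_linear p \<sigma>)"
  by (rule linearI) (simp_all add: heis_motion_linear_def heis_eq_iff sympl_simps
      matrix_vector_right_distrib matrix_vector_mult_scaleR field_simps)

lemma heis_motion_compose:
  assumes "\<sigma> \<in> Sp_omega"
  shows "heis_motion p \<sigma> \<circ> heis_motion q \<tau> = heis_motion (heis_mult p (f_sigma \<sigma> q)) (\<sigma> ** \<tau>)"
  by (simp add: fun_eq_iff heis_motion_def f_sigma_heis_mult[OF assms] f_sigma_mult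
      heis_mult_assoc)

lemma heis_motion_id: "heis_motion 0 (mat 1) = id"
  by (simp add: fun_eq_iff heis_motion_def)

lemma heis_motion_inject:
  assumes "heis_motion p \<sigma> = heis_motion q \<tau>"
  shows "p = q" "\<sigma> = \<tau>"
proof -
  have eq: "heis_mult p (f_sigma \<sigma> r) = heis_mult q (f_sigma \<tau> r)" for r
    using fun_cong[OF assms, of r] by (simp add: heis_motion_def)
  show "p = q"
    using eq[of 0] by (simp add: linear_0[OF linear_f_sigma])
  then have "\<sigma> *v u = \<tau> *v u" for u
    using eq[of "heis_of u 0"] by (simp add: heis_eq_iff)
  then show "\<sigma> = \<tau>"
    by (simp add: matrix_eq)
qed

lemma Ck_const: "Ck k (\<lambda>x. c)"
  by (induction k arbitrary: c) (simp_all add: frechet_derivative_const)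

lemma frechet_derivative_affine:
  assumes "bounded_linear A"
  shows "frechet_derivative (\<lambda>x. c + A x) (at x) = A"
proof (rule frechet_derivative_at[symmetric])
  show "((\<lambda>x. c + A x) has_derivative A) (at x)"
    using has_derivative_add[OF has_derivative_const bounded_linear_imp_has_derivative[OF assms]]
    by simp
qed

lemma smooth_affine:
  assumes "bounded_linear A"
  shows "smooth (\<lambda>x. c + A x)"
proof -
  have d: "(\<lambda>x. c + A x) differentiable at x" for x
    by (intro derivative_intros bounded_linear_imp_differentiable assms)
  have "Ck k (\<lambda>x. c + A x)" for k
  proof (cases k)
    case 0
    have "continuous_on UNIV (\<lambda>x. c + A x)"
      by (intro continuous_intros linear_continuous_on assms)
    then show ?thesis using 0 by simp
  next
    case (Suc m)
    then show ?thesis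
      by (simp add: d frechet_derivative_affine[OF assms] Ck_const)
  qed
  then show ?thesis by (simp add: smooth_def)
qed

lemma bounded_linear_heis_motion_linear: "bounded_linear (heis_motion_linear p \<sigma>)"
  using linear_heis_motion_linear by (simp add: linear_conv_bounded_linear)

lemma pushforward_heis_motion: "pushforward (heis_motion p \<sigma>) q = heis_motion_linear p \<sigma>"
  unfolding heis_motion_affine[abs_def]
  by (rule frechet_derivative_affine[OF bounded_linear_heis_motion_linear])

lemma smooth_heis_motion: "smooth (heis_motion p \<sigma>)"
  unfolding heis_motion_affine[abs_def]
  by (rule smooth_affine[OF bounded_linear_heis_motion_linear])

lemma heis_motion_linear_omega:
  assumes "\<sigma> \<in> Sp_omega"
  shows "heis_omega (heis_motion_linear p \<sigma> v) (heis_motion_linear p \<sigma> w) = heis_omega v w"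
  using assms by (simp add: heis_omega_sympl heis_motion_linear_def Sp_omega_iff)

lemma heis_motion_linear_alpha:
  assumes "\<sigma> \<in> Sp_omega"
  shows "heis_alpha (heis_motion p \<sigma> q) (heis_motion_linear p \<sigma> v) = heis_alpha q v"
  using assms
  by (simp add: heis_alpha_sympl heis_motion_affine heis_motion_linear_def Sp_omega_iff
      sympl_simps add_divide_distrib)

lemma heis_motion_inverse:
  assumes "\<sigma> \<in> Sp_omega"
  obtains q \<tau> where "heis_motion p \<sigma> \<circ> heis_motion q \<tau> = id"
    and "heis_motion q \<tau> \<circ> heis_motion p \<sigma> = id"
proof -
  obtain \<tau> where \<tau>: "\<tau> ** \<sigma> = mat 1" "\<sigma> ** \<tau> = mat 1"
    using Sp_omega_inverse[OF assms] .
  have inv: "\<sigma> *v (\<tau> *v u) = u" for u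
    using \<tau>(2) by (simp add: matrix_vector_mul_assoc)
  then have "\<tau> \<in> Sp_omega"
    using assms unfolding Sp_omega_iff by metis
  then have "heis_motion (f_sigma \<tau> (- p)) \<tau> \<circ> heis_motion p \<sigma> = id"
    by (simp add: heis_motion_compose \<tau> heis_motion_id heis_mult_uminus
        linear_0[OF linear_f_sigma] flip: f_sigma_heis_mult)
  moreover have "heis_motion p \<sigma> \<circ> heis_motion (f_sigma \<tau> (- p)) \<tau> = id"
    using assms
    by (simp add: heis_motion_compose \<tau> heis_motion_id heis_mult_uminus flip: f_sigma_mult)
  ultimately show ?thesis
    using that by blast
qed

lemma isometry_heis_motion:
  assumes g: "heis_metric t s g" and \<sigma>: "\<sigma> \<in> Sp_omega" "\<sigma> \<in> O_metric g"
  shows "isometry heis_H g (heis_motion p \<sigma>)"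
proof -
  let ?f = "heis_motion p \<sigma>" and ?A = "heis_motion_linear p \<sigma>"
  obtain q \<tau> where inv: "?f \<circ> heis_motion q \<tau> = id" "heis_motion q \<tau> \<circ> ?f = id"
    using heis_motion_inverse[OF \<sigma>(1)] .
  have bij: "bij ?f"
    using inv o_bij by blast
  have "inv_into UNIV ?f = heis_motion q \<tau>"
    using inv by (rule inv_unique_comp)
  then have "diffeomorphism ?f"
    by (simp add: diffeomorphism_def bij smooth_heis_motion)
  moreover have "?A ` heis_H r = heis_H (?f r)" for r
  proof
    show "?A ` heis_H r \<subseteq> heis_H (?f r)"
      by (auto simp: heis_H_iff heis_motion_linear_alpha[OF \<sigma>(1)] simp del: split_paired_All)
    show "heis_H (?f r) \<subseteq> ?A ` heis_H r"
    proof
      fix w assume w: "w \<in> heis_H (?f r)"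
      obtain v where "?f v = p + w"
        using bij by (metis bij_pointE)
      then have "?A v = w"
        by (simp add: heis_motion_affine)
      then show "w \<in> ?A ` heis_H r"
        using w heis_motion_linear_alpha[OF \<sigma>(1), of p r v] by (metis heis_H_iff image_eqI)
    qed
  qed
  moreover have "g (?f r) (?A v) (?A w) = g r v w" if "v \<in> heis_H r" "w \<in> heis_H r" for r v w
  proof -
    have "?A v \<in> heis_H (?f r)" "?A w \<in> heis_H (?f r)"
      using that by (simp_all add: heis_H_iff heis_motion_linear_alpha[OF \<sigma>(1)])
    then show ?thesis
      using \<sigma>(2) that unfolding O_metric_iff[OF g]
      by (simp add: heis_metric_flat_metric[OF g] heis_motion_linear_def)
  qed
  ultimately show ?thesis
    by (simp add: isometry_def pushforward_heis_motion)
qed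

section \<open>Symmetry of second derivatives\<close>

abbreviation second_derivative ::
  "('a::euclidean_space \<Rightarrow> 'b::euclidean_space) \<Rightarrow> 'a \<Rightarrow> 'a \<Rightarrow> 'a \<Rightarrow> 'b" where
  "second_derivative f q w v \<equiv>
     frechet_derivative (\<lambda>p. frechet_derivative f (at p) w) (at q) v"

lemma Ck2_has_derivative:
  assumes "Ck 2 f"
  shows "(f has_derivative frechet_derivative f (at q)) (at q)"
    and "((\<lambda>p. frechet_derivative f (at p) w) has_derivative second_derivative f q w) (at q)"
proof -
  have "f differentiable at q" "(\<lambda>p. frechet_derivative f (at p) w) differentiable at q"
    using assms by (simp_all add: numeral_2_eq_2 del: split_paired_All)
  then show "(f has_derivative frechet_derivative f (at q)) (at q)"
    and "((\<lambda>p. frechet_derivative f (at p) w) has_derivative second_derivative f q w) (at q)"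
    by (simp_all add: frechet_derivative_works)
qed

lemma mean_value_direction:
  fixes h :: "'a::euclidean_space \<Rightarrow> real"
  assumes "\<And>x. h differentiable at x" and "0 < s"
  obtains \<xi> where "0 \<le> \<xi>" "\<xi> \<le> s"
    and "h (q + s *\<^sub>R u) - h q = s * frechet_derivative h (at (q + \<xi> *\<^sub>R u)) u"
proof -
  have d: "((\<lambda>r. h (q + r *\<^sub>R u)) has_real_derivative
      frechet_derivative h (at (q + r *\<^sub>R u)) u) (at r)" for r
  proof -
    have h: "(h has_derivative frechet_derivative h (at (q + r *\<^sub>R u))) (at (q + r *\<^sub>R u))"
      using assms(1) frechet_derivative_works by blast
    then have lin: "linear (frechet_derivative h (at (q + r *\<^sub>R u)))"
      by (rule has_derivative_linear)
    have "((\<lambda>r. h (q + r *\<^sub>R u)) has_derivative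
        (\<lambda>k. frechet_derivative h (at (q + r *\<^sub>R u)) (k *\<^sub>R u))) (at r)"
      by (rule has_derivative_compose[where f = "\<lambda>r. q + r *\<^sub>R u" and g = h, OF _ h]) (auto intro!: derivative_eq_intros)
    then show ?thesis
      by (simp add: has_field_derivative_def linear_cmul[OF lin] mult_commute_abs)
  qed
  obtain \<xi> where "0 < \<xi>" "\<xi> < s"
    and "h (q + s *\<^sub>R u) - h (q + 0 *\<^sub>R u)
      = (s - 0) * frechet_derivative h (at (q + \<xi> *\<^sub>R u)) u"
    using MVT2[OF \<open>0 < s\<close> d] by blast
  then show ?thesis
    using that[of \<xi>] by simp
qed

text \<open>The second difference over a parallelogram with sides \<open>s u\<close> and \<open>s v\<close> does not depend on the
  order of the two directions; divided by \<open>s\<^sup>2\<close> it tends to either mixed derivative as \<open>s\<close> goes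
  to zero.\<close>

lemma second_derivative_symmetric_real:
  fixes h :: "'a::euclidean_space \<Rightarrow> real"
  assumes "Ck 2 h"
  shows "second_derivative h q u v = second_derivative h q v u"
proof (rule ccontr)
  let ?D = "second_derivative h"
  assume ne: "?D q u v \<noteq> ?D q v u"
  have diff: "h differentiable at x" "(\<lambda>p. frechet_derivative h (at p) w) differentiable at x"
    and cont: "continuous_on UNIV (\<lambda>p. ?D p w w')" for x w w'
    using assms by (simp_all add: numeral_2_eq_2)
  \<comment> \<open>The second difference of h over a small parallelogram is a value of the second derivative
    at some point of the parallelogram, in either order of the directions.\<close>
  have difference: "\<exists>\<xi> \<eta>. 0 \<le> \<xi> \<and> \<xi> \<le> s \<and> 0 \<le> \<eta> \<and> \<eta> \<le> s \<and>
      h (q + s *\<^sub>R u + s *\<^sub>R v) - h (q + s *\<^sub>R u) - h (q + s *\<^sub>R v) + h q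
        = s * s * ?D (q + \<xi> *\<^sub>R u + \<eta> *\<^sub>R v) u v"
    if pos: "0 < s" for s u v
  proof -
    have h_shift: "((\<lambda>x. h (x + s *\<^sub>R v)) has_derivative frechet_derivative h (at (x + s *\<^sub>R v))) (at x)"
      for x
    proof -
      have "(h has_derivative frechet_derivative h (at (x + s *\<^sub>R v))) (at (x + s *\<^sub>R v))"
        using diff(1) frechet_derivative_works by blast
      moreover have "((\<lambda>x. x + s *\<^sub>R v) has_derivative (\<lambda>k. k)) (at x)"
        by (auto intro!: derivative_eq_intros)
      ultimately show ?thesis
        using has_derivative_compose[where f = "\<lambda>x. x + s *\<^sub>R v" and g = h] by blast
    qed
    have k: "((\<lambda>x. h (x + s *\<^sub>R v) - h x) has_derivative
        (\<lambda>k. frechet_derivative h (at (x + s *\<^sub>R v)) k - frechet_derivative h (at x) k)) (at x)" for x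
      using h_shift diff(1)[of x] by (intro has_derivative_diff) (auto simp: frechet_derivative_works)
    then have kd: "(\<lambda>x. h (x + s *\<^sub>R v) - h x) differentiable at x" for x
      by (auto simp: differentiable_def)
    obtain \<xi> where \<xi>: "0 \<le> \<xi>" "\<xi> \<le> s" and first:
      "(h (q + s *\<^sub>R u + s *\<^sub>R v) - h (q + s *\<^sub>R u)) - (h (q + s *\<^sub>R v) - h q)
        = s * frechet_derivative (\<lambda>x. h (x + s *\<^sub>R v) - h x) (at (q + \<xi> *\<^sub>R u)) u"
      by (rule mean_value_direction[OF kd pos, where q = q and u = u])
    have "frechet_derivative (\<lambda>x. h (x + s *\<^sub>R v) - h x) (at (q + \<xi> *\<^sub>R u)) u
      = frechet_derivative h (at (q + \<xi> *\<^sub>R u + s *\<^sub>R v)) u - frechet_derivative h (at (q + \<xi> *\<^sub>R u)) u"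
      using frechet_derivative_at[OF k[of "q + \<xi> *\<^sub>R u"], symmetric] by simp
    with first have 1: "h (q + s *\<^sub>R u + s *\<^sub>R v) - h (q + s *\<^sub>R u) - h (q + s *\<^sub>R v) + h q
        = s * (frechet_derivative h (at (q + \<xi> *\<^sub>R u + s *\<^sub>R v)) u
            - frechet_derivative h (at (q + \<xi> *\<^sub>R u)) u)"
      by simp
    obtain \<eta> where \<eta>: "0 \<le> \<eta>" "\<eta> \<le> s" and
      "frechet_derivative h (at (q + \<xi> *\<^sub>R u + s *\<^sub>R v)) u - frechet_derivative h (at (q + \<xi> *\<^sub>R u)) u
        = s * ?D (q + \<xi> *\<^sub>R u + \<eta> *\<^sub>R v) u v"
      by (rule mean_value_direction[OF diff(2) pos, where q = "q + \<xi> *\<^sub>R u" and u = v])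
    with \<xi> 1 show ?thesis by (intro exI[of _ \<xi>] exI[of _ \<eta>]) simp
  qed
  define \<epsilon> where "\<epsilon> = \<bar>?D q u v - ?D q v u\<bar> / 2"
  have "\<epsilon> > 0"
    using ne by (simp add: \<epsilon>_def)
  have near: "\<exists>\<delta>>0. \<forall>x. dist x q < \<delta> \<longrightarrow> \<bar>?D x w w' - ?D q w w'\<bar> < \<epsilon>" for w w'
    using cont[of w w'] \<open>\<epsilon> > 0\<close> unfolding continuous_on_iff dist_real_def by blast
  obtain \<delta>1 \<delta>2 where \<delta>: "\<delta>1 > 0" "\<delta>2 > 0"
    and near1: "\<And>x. dist x q < \<delta>1 \<Longrightarrow> \<bar>?D x u v - ?D q u v\<bar> < \<epsilon>"
    and near2: "\<And>x. dist x q < \<delta>2 \<Longrightarrow> \<bar>?D x v u - ?D q v u\<bar> < \<epsilon>"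
    using near[of u v] near[of v u] by blast
  \<comment> \<open>So small that the parallelogram lies in both neighbourhoods.\<close>
  define s where "s = min \<delta>1 \<delta>2 / (2 * (norm u + norm v + 1))"
  have "s > 0"
    using \<delta> by (auto simp: s_def intro!: divide_pos_pos add_nonneg_pos)
  have "s * (2 * (norm u + norm v + 1)) = min \<delta>1 \<delta>2"
    using norm_ge_zero[of u] norm_ge_zero[of v] unfolding s_def by (simp add: add_nonneg_eq_0_iff)
  have small: "dist (q + \<xi> *\<^sub>R u + \<eta> *\<^sub>R v) q < min \<delta>1 \<delta>2"
    if "0 \<le> \<xi>" "\<xi> \<le> s" "0 \<le> \<eta>" "\<eta> \<le> s" for \<xi> \<eta>
  proof -
    have "dist (q + \<xi> *\<^sub>R u + \<eta> *\<^sub>R v) q = norm (\<xi> *\<^sub>R u + \<eta> *\<^sub>R v)"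
      by (simp add: dist_norm algebra_simps)
    also have "\<dots> \<le> \<xi> * norm u + \<eta> * norm v"
      using norm_triangle_ineq[of "\<xi> *\<^sub>R u" "\<eta> *\<^sub>R v"] that by simp
    also have "\<dots> \<le> s * norm u + s * norm v"
      using that by (intro add_mono mult_right_mono) auto
    also have "\<dots> < s * (2 * (norm u + norm v + 1))"
      using \<open>s > 0\<close> by (simp add: distrib_left add_nonneg_pos add_strict_increasing)
    finally show ?thesis
      using \<open>s * (2 * (norm u + norm v + 1)) = min \<delta>1 \<delta>2\<close> by simp
  qed
  obtain \<xi> \<eta> where 1: "0 \<le> \<xi>" "\<xi> \<le> s" "0 \<le> \<eta>" "\<eta> \<le> s"
    "h (q + s *\<^sub>R u + s *\<^sub>R v) - h (q + s *\<^sub>R u) - h (q + s *\<^sub>R v) + h q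
      = s * s * ?D (q + \<xi> *\<^sub>R u + \<eta> *\<^sub>R v) u v"
    using difference[OF \<open>s > 0\<close>] by blast
  obtain \<xi>' \<eta>' where 2: "0 \<le> \<xi>'" "\<xi>' \<le> s" "0 \<le> \<eta>'" "\<eta>' \<le> s"
    "h (q + s *\<^sub>R v + s *\<^sub>R u) - h (q + s *\<^sub>R v) - h (q + s *\<^sub>R u) + h q
      = s * s * ?D (q + \<xi>' *\<^sub>R v + \<eta>' *\<^sub>R u) v u"
    using difference[OF \<open>s > 0\<close>] by blast
  have "s * s * ?D (q + \<xi> *\<^sub>R u + \<eta> *\<^sub>R v) u v = s * s * ?D (q + \<xi>' *\<^sub>R v + \<eta>' *\<^sub>R u) v u"
    unfolding 1(5)[symmetric] 2(5)[symmetric] by (simp add: add.commute add.left_commute)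
  then have "?D (q + \<xi> *\<^sub>R u + \<eta> *\<^sub>R v) u v = ?D (q + \<eta>' *\<^sub>R u + \<xi>' *\<^sub>R v) v u"
    using \<open>s > 0\<close> by (simp add: add.commute add.left_commute)
  moreover have "\<bar>?D (q + \<xi> *\<^sub>R u + \<eta> *\<^sub>R v) u v - ?D q u v\<bar> < \<epsilon>"
    using near1 small[OF 1(1-4)] by simp
  moreover have "\<bar>?D (q + \<eta>' *\<^sub>R u + \<xi>' *\<^sub>R v) v u - ?D q v u\<bar> < \<epsilon>"
    using near2 small[OF 2(3,4,1,2)] by simp
  ultimately have "\<bar>?D q u v - ?D q v u\<bar> < \<epsilon> + \<epsilon>"
    by linarith
  then show False
    by (simp add: \<epsilon>_def)
qed

lemma second_derivative_symmetric:
  fixes f :: "'a::euclidean_space \<Rightarrow> 'b::euclidean_space"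
  assumes "Ck 2 f"
  shows "second_derivative f q u v = second_derivative f q v u"
proof (rule euclidean_eqI)
  fix b :: 'b assume "b \<in> Basis"
  have diff: "f differentiable at x" "(\<lambda>p. frechet_derivative f (at p) w) differentiable at x"
    and cont: "continuous_on UNIV (\<lambda>p. second_derivative f p w w')" for x w w'
    using assms by (simp_all add: numeral_2_eq_2)
  have comp: "((\<lambda>x. k x \<bullet> b) has_derivative (\<lambda>v. frechet_derivative k (at x) v \<bullet> b)) (at x)"
    if "k differentiable at x" for k :: "'a \<Rightarrow> 'b" and x
    using that by (intro has_derivative_inner_left) (simp add: frechet_derivative_works)
  have fd: "frechet_derivative (\<lambda>x. k x \<bullet> b) (at x) = (\<lambda>v. frechet_derivative k (at x) v \<bullet> b)"
    if "k differentiable at x" for k :: "'a \<Rightarrow> 'b" and x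
    using frechet_derivative_at[OF comp[OF that]] by simp
  have "(\<lambda>x. k x \<bullet> b) differentiable at x" if "k differentiable at x" for k :: "'a \<Rightarrow> 'b" and x
    using comp[OF that] by (auto simp: differentiable_def)
  then have "Ck 2 (\<lambda>x. f x \<bullet> b)"
    using cont by (auto simp: numeral_2_eq_2 fd diff intro!: continuous_intros)
  from second_derivative_symmetric_real[OF this, where q = q and u = u and v = v]
  show "second_derivative f q u v \<bullet> b = second_derivative f q v u \<bullet> b"
    by (simp add: fd diff)
qed

section \<open>Isometries scale the contact form by a sign\<close>

text \<open>Let \<open>A\<close> be the operator with \<open>\<omega>(u, v) = B(u, A v)\<close>, where \<open>B\<close> is the metric. A linear isometry
  \<open>S\<close> that scales \<open>\<omega>\<close> by \<open>c\<close> satisfies \<open>A S = c S A\<close>. The square of \<open>A\<close> is diagonal with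
  entries \<open>- t\<^sub>i s\<^sub>i = \<plusminus>1\<close>, so \<open>A\<^sup>4 = 1\<close> and therefore \<open>c\<^sup>4 = 1\<close>.\<close>

lemma symplectic_similitude_factor:
  fixes t s :: "'n::finite \<Rightarrow> real" and S :: "real ^ ('n + 'n) \<Rightarrow> real ^ ('n + 'n)"
  assumes signs: "\<And>i. t i \<in> {-1, 1}" "\<And>i. s i \<in> {-1, 1}"
    and S: "linear S" "surj S"
    and metric: "\<And>u v. flat_metric (case_sum t s) (S u) (S v) = flat_metric (case_sum t s) u v"
    and sympl: "\<And>u v. sympl (S u) (S v) = c * sympl u v"
  shows "c\<^sup>2 = 1"
proof -
  let ?B = "flat_metric (case_sum t s)"
  define A :: "real ^ ('n + 'n) \<Rightarrow> real ^ ('n + 'n)"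
    where "A v = (\<chi> k. case k of Inl i \<Rightarrow> t i * v $ Inr i | Inr i \<Rightarrow> - (s i * v $ Inl i))" for v
  have sq: "t i * t i = 1" "s i * s i = 1" for i
    using signs(1)[of i] signs(2)[of i] by auto
  have A: "sympl u v = ?B u (A v)" for u v
  proof -
    have "t i * u $ Inl i * (t i * v $ Inr i) + s i * u $ Inr i * - (s i * v $ Inl i)
        = (t i * t i) * (u $ Inl i * v $ Inr i) - (s i * s i) * (u $ Inr i * v $ Inl i)" for i
      by (simp only: mult_ac mult_minus_right add_uminus_conv_diff)
    then show ?thesis
      by (simp add: sympl_def flat_metric_def sum_UNIV_sum A_def sq)
  qed
  have A4: "A (A (A (A v))) = v" for v
  proof -
    have "t i * (s i * (t i * (s i * r))) = (t i * t i) * (s i * s i) * r"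
      "s i * (t i * (s i * (t i * r))) = (t i * t i) * (s i * s i) * r" for i r
      by (simp_all only: mult_ac)
    then show ?thesis
      by (simp add: vec_eq_iff A_def sq split: sum.split)
  qed
  have A_scale: "A (r *\<^sub>R v) = r *\<^sub>R A v" for r v
    by (simp add: vec_eq_iff A_def split: sum.split)
  have nz: "case_sum t s k \<noteq> 0" for k
    using signs by (rule case_sum_signs_nonzero)
  have AS: "A (S v) = c *\<^sub>R S (A v)" for v
  proof -
    have "?B (A (S v) - c *\<^sub>R S (A v)) w = 0" for w
    proof -
      obtain u where u: "w = S u"
        using S(2) by blast
      have "?B (S u) (A (S v)) = c * ?B (S u) (S (A v))"
        using sympl[of u v] by (simp add: A metric)
      then show ?thesis
        unfolding u flat_metric_commute[of _ _ "S u"]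
        by (simp add: bilinear_rsub[OF bilinear_flat_metric] bilinear_rmul[OF bilinear_flat_metric])
    qed
    from flat_metric_nondegenerate[OF nz this] show ?thesis
      by simp
  qed
  have scale: "S v = (c ^ 4) *\<^sub>R S v" for v
  proof -
    have "S v = A (A (A (A (S v))))"
      by (simp add: A4)
    also have "\<dots> = (c ^ 4) *\<^sub>R S (A (A (A (A v))))"
      by (simp add: AS A_scale power4_eq_xxxx mult.assoc)
    finally show ?thesis
      by (simp add: A4)
  qed
  obtain v where "S v = (\<chi> k. 1)"
    using S(2) by (metis surj_def)
  with scale[of v] have "c ^ 4 = 1"
    by (simp add: vec_eq_iff)
  then have "(c\<^sup>2 - 1) * (c\<^sup>2 + 1) = 0"
    by (simp add: algebra_simps flip: power_add)
  then show ?thesis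
    using zero_le_power2[of c] by (auto simp: add_eq_0_iff)
qed

lemma affine_if_constant_derivative:
  fixes h :: "'a::real_normed_vector \<Rightarrow> 'b::real_normed_vector"
  assumes h: "\<And>q. (h has_derivative A) (at q)"
  shows "h q = h 0 + A q"
proof -
  have A: "bounded_linear A"
    by (rule has_derivative_bounded_linear[OF h])
  have "\<exists>c. \<forall>p\<in>UNIV. h p - A p = c"
  proof (rule has_derivative_zero_constant)
    show "((\<lambda>p. h p - A p) has_derivative (\<lambda>v. 0)) (at r within UNIV)" for r
      using has_derivative_diff[OF h bounded_linear_imp_has_derivative[OF A]] by simp
  qed simp
  then have "h q - A q = h 0 - A 0"
    by auto
  then show ?thesis
    by (simp add: linear_0[OF bounded_linear.linear[OF A]] algebra_simps)
qed

lemma has_derivative_heis_alpha: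
  assumes "(F has_derivative F') (at q)" "(W has_derivative W') (at q)"
  shows "((\<lambda>p. heis_alpha (F p) (W p)) has_derivative
    (\<lambda>v. zc (W' v) + (sympl (horiz (F q)) (horiz (W' v)) + sympl (horiz (F' v)) (horiz (W q))) / 2))
    (at q)"
proof -
  have "((\<lambda>p. zc (W p)) has_derivative (\<lambda>v. zc (W' v))) (at q)"
    by (rule bounded_linear.has_derivative[OF bounded_linear_zc assms(2)])
  moreover have "((\<lambda>p. sympl (horiz (F p)) (horiz (W p))) has_derivative
      (\<lambda>v. sympl (horiz (F q)) (horiz (W' v)) + sympl (horiz (F' v)) (horiz (W q)))) (at q)"
    by (intro bounded_bilinear.FDERIV[OF sympl_bounded_bilinear]
        bounded_linear.has_derivative[OF bounded_linear_horiz] assms)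
  ultimately show ?thesis
    unfolding heis_alpha_sympl
    by (intro has_derivative_add bounded_linear.has_derivative[OF bounded_linear_divide])
qed

locale heis_isometry =
  fixes t s :: "'n::finite \<Rightarrow> real"
    and g :: "'n heis \<Rightarrow> 'n heis \<Rightarrow> 'n heis \<Rightarrow> real"
    and f :: "'n heis \<Rightarrow> 'n heis"
  assumes signs: "\<And>i. t i \<in> {-1, 1}" "\<And>i. s i \<in> {-1, 1}"
    and metric: "heis_metric t s g"
    and isometry: "isometry heis_H g f"
begin

abbreviation B :: "real ^ ('n + 'n) \<Rightarrow> real ^ ('n + 'n) \<Rightarrow> real" where
  "B \<equiv> flat_metric (case_sum t s)"

abbreviation Z :: "'n heis" where
  "Z \<equiv> heis_of 0 1"

abbreviation D :: "'n heis \<Rightarrow> 'n heis \<Rightarrow> 'n heis" where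
  "D \<equiv> pushforward f"

abbreviation D2 :: "'n heis \<Rightarrow> 'n heis \<Rightarrow> 'n heis \<Rightarrow> 'n heis" where
  "D2 \<equiv> second_derivative f"

text \<open>The differential on the fibre of \<open>H\<close> over \<open>q\<close>, read in the left-invariant frames at \<open>q\<close> and at
  \<open>f q\<close>.\<close>

definition S :: "'n heis \<Rightarrow> real ^ ('n + 'n) \<Rightarrow> real ^ ('n + 'n)" where
  "S q u = horiz (D q (heis_frame q u))"

text \<open>The function \<open>\<phi>\<close> in \<open>f\<^sup>*\<alpha> = \<phi> \<alpha>\<close>. It can be read off from the central field \<open>Z\<close>, on which \<open>\<alpha>\<close>
  is 1.\<close>

definition factor :: "'n heis \<Rightarrow> real" where
  "factor q = heis_alpha (f q) (D q Z)"

lemma Ck2: "Ck 2 f"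
  using isometry by (simp add: isometry_def diffeomorphism_def smooth_def)

lemma f_has_derivative: "(f has_derivative D q) (at q)"
  by (rule Ck2_has_derivative(1)[OF Ck2])

lemma linear_D: "linear (D q)"
  by (rule has_derivative_linear[OF f_has_derivative])

lemma D_has_derivative: "((\<lambda>p. D p w) has_derivative D2 q w) (at q)"
  by (rule Ck2_has_derivative(2)[OF Ck2])

lemma D2_commute: "D2 q v w = D2 q w v"
  by (rule second_derivative_symmetric[OF Ck2])

lemma D_image: "D q ` heis_H q = heis_H (f q)"
  using isometry unfolding isometry_def by blast

lemma D_metric:
  "v \<in> heis_H q \<Longrightarrow> w \<in> heis_H q \<Longrightarrow> g (f q) (D q v) (D q w) = g q v w"
  using isometry unfolding isometry_def by blast

lemma alpha_Z [simp]: "heis_alpha q Z = 1"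
  by (simp add: heis_alpha_sympl sympl_simps)

lemma frame_decomposition: "v = heis_frame q (horiz v) + heis_alpha q v *\<^sub>R Z"
  by (simp add: heis_eq_iff zc_heis_frame heis_alpha_sympl)

lemma D_frame: "D q (heis_frame q u) = heis_frame (f q) (S q u)"
proof -
  have "D q (heis_frame q u) \<in> heis_H (f q)"
    using D_image heis_frame_in_heis_H by blast
  then show ?thesis
    by (simp add: S_def heis_H_iff heis_frame_horiz)
qed

lemma alpha_D: "heis_alpha (f q) (D q v) = factor q * heis_alpha q v"
proof -
  have "heis_alpha (f q) (D q v)
      = heis_alpha (f q) (D q (heis_frame q (horiz v) + heis_alpha q v *\<^sub>R Z))"
    using frame_decomposition[of v q] by simp
  then show ?thesis
    by (simp only: linear_add[OF linear_D] linear_cmul[OF linear_D] D_frame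
        linear_add[OF linear_heis_alpha] linear_cmul[OF linear_heis_alpha]
        heis_alpha_heis_frame factor_def) simp
qed

lemma linear_S: "linear (S q)"
  unfolding S_def
  using linear_compose[OF linear_compose[OF linear_heis_frame linear_D] linear_horiz]
  by (simp add: comp_def)

lemma surj_S: "surj (S q)"
  unfolding surj_def
proof
  fix y
  have "heis_frame (f q) y \<in> D q ` heis_H q"
    using D_image heis_frame_in_heis_H by blast
  then obtain v where "v \<in> heis_H q" "D q v = heis_frame (f q) y"
    by (metis imageE)
  then have "y = S q (horiz v)"
    by (simp add: S_def heis_frame_horiz heis_H_iff)
  then show "\<exists>x. y = S q x" by blast
qed

lemma B_S: "B (S q u) (S q v) = B u v"
  using D_metric[OF heis_frame_in_heis_H heis_frame_in_heis_H, of q u v]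
  by (simp add: D_frame heis_metric_flat_metric[OF metric] heis_frame_in_heis_H)

text \<open>This is the exterior derivative of \<open>f\<^sup>*\<alpha> = \<phi> \<alpha>\<close>, that is,
  \<open>f\<^sup>*\<omega> = d\<phi> \<and> \<alpha> + \<phi> \<omega>\<close>: differentiate \<open>\<alpha>(D w)\<close> in the direction \<open>v\<close> and antisymmetrise, which
  removes the second derivatives of \<open>f\<close>.\<close>

lemma omega_D:
  obtains \<phi>' where "(factor has_derivative \<phi>') (at q)"
    and "\<And>v w. heis_omega (D q v) (D q w)
      = \<phi>' v * heis_alpha q w - \<phi>' w * heis_alpha q v + factor q * heis_omega v w"
proof -
  have alpha': "((\<lambda>p. heis_alpha (f p) (D p w)) has_derivative
      (\<lambda>v. zc (D2 q w v)
        + (sympl (horiz (f q)) (horiz (D2 q w v)) + sympl (horiz (D q v)) (horiz (D q w))) / 2)) (at q)"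
    for w
    by (rule has_derivative_heis_alpha[OF f_has_derivative D_has_derivative])
  obtain \<phi>' where \<phi>': "(factor has_derivative \<phi>') (at q)"
    using alpha'[of Z] unfolding factor_def[abs_def] by blast
  have "((\<lambda>p. heis_alpha p w) has_derivative (\<lambda>v. sympl (horiz v) (horiz w) / 2)) (at q)" for w
    using has_derivative_heis_alpha[OF has_derivative_ident has_derivative_const[of w], where q = q]
    by (simp add: sympl_simps)
  from has_derivative_mult[OF \<phi>' this]
  have "((\<lambda>p. heis_alpha (f p) (D p w)) has_derivative
      (\<lambda>v. factor q * (sympl (horiz v) (horiz w) / 2) + \<phi>' v * heis_alpha q w)) (at q)" for w
    by (simp add: alpha_D)
  from has_derivative_unique[OF alpha' this]
  have eq: "zc (D2 q w v)
      + (sympl (horiz (f q)) (horiz (D2 q w v)) + sympl (horiz (D q v)) (horiz (D q w))) / 2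
      = factor q * (sympl (horiz v) (horiz w) / 2) + \<phi>' v * heis_alpha q w" for v w
    by metis
  have "heis_omega (D q v) (D q w)
      = \<phi>' v * heis_alpha q w - \<phi>' w * heis_alpha q v + factor q * heis_omega v w" for v w
    using eq[of w v] eq[of v w] D2_commute[where q = q and v = v and w = w]
      sympl_commute[of "horiz (D q v)" "horiz (D q w)"] sympl_commute[of "horiz v" "horiz w"]
    by (simp add: heis_omega_sympl field_simps)
  with \<phi>' show ?thesis
    using that by blast
qed

lemma sympl_S: "sympl (S q u) (S q v) = factor q * sympl u v"
proof -
  obtain \<phi>' where "\<And>v w. heis_omega (D q v) (D q w)
      = \<phi>' v * heis_alpha q w - \<phi>' w * heis_alpha q v + factor q * heis_omega v w"
    using omega_D by metis
  from this[of "heis_frame q u" "heis_frame q v"] show ?thesis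
    by (simp add: heis_omega_sympl D_frame)
qed

lemma factor_squared: "(factor q)\<^sup>2 = 1"
  by (rule symplectic_similitude_factor[OF signs linear_S surj_S B_S sympl_S])

text \<open>Since \<open>\<phi>\<^sup>2 = 1\<close> everywhere, \<open>d\<phi> = 0\<close> and the first term of \<open>f\<^sup>*\<omega>\<close> drops out.\<close>

lemma omega_D_scaled: "heis_omega (D q v) (D q w) = factor q * heis_omega v w"
proof -
  obtain \<phi>' where \<phi>': "(factor has_derivative \<phi>') (at q)"
    and omega: "heis_omega (D q v) (D q w)
      = \<phi>' v * heis_alpha q w - \<phi>' w * heis_alpha q v + factor q * heis_omega v w"
    using omega_D by metis
  have "((\<lambda>p. factor p * factor p) has_derivative (\<lambda>v. factor q * \<phi>' v + \<phi>' v * factor q)) (at q)"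
    by (rule has_derivative_mult[OF \<phi>' \<phi>'])
  moreover have "(\<lambda>p. factor p * factor p) = (\<lambda>p. 1)"
    using factor_squared by (simp add: power2_eq_square)
  ultimately have "((\<lambda>p. 1) has_derivative (\<lambda>v. factor q * \<phi>' v + \<phi>' v * factor q)) (at q)"
    by (simp only:)
  from fun_cong[OF has_derivative_unique[OF this has_derivative_const]]
  have "factor q * \<phi>' v = 0" for v
    by (simp add: mult.commute)
  moreover have "factor q \<noteq> 0"
    using factor_squared[of q] by auto
  ultimately have "\<phi>' v = 0" for v
    by (metis mult_eq_0_iff)
  then show ?thesis
    using omega by simp
qed

lemma factor_eq_1:
  assumes "orientation_preserving f"
  shows "factor q = 1"
proof -
  obtain w :: "nat \<Rightarrow> 'n heis" where w: "\<And>i. i < 2 * CARD('n) \<Longrightarrow> w i \<in> heis_H q"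
    "0 < heis_H_form q w" "0 < heis_volume_form q w"
    using positive_frame[of q] by metis
  note scale = orientation_forms_scale[of "D q" "factor q" "f q" q, OF omega_D_scaled alpha_D]
  have "0 < heis_H_form (f q) (\<lambda>i. D q (w i))" "0 < heis_volume_form (f q) (\<lambda>i. D q (w i))"
    using assms w unfolding orientation_preserving_def by blast+
  then have "0 < factor q ^ CARD('n)" "0 < factor q * factor q ^ CARD('n)"
    using w by (simp_all add: scale zero_less_mult_iff)
  then have "0 < factor q"
    using zero_less_mult_pos2 by blast
  with factor_squared[of q] show ?thesis
    by (simp add: power2_eq_1_iff)
qed

end

section \<open>Rigidity\<close>

locale oriented_heis_isometry = heis_isometry +
  assumes oriented: "orientation_preserving f"
begin

lemma omega_D_eq: "heis_omega (D q v) (D q w) = heis_omega v w"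
  by (simp add: omega_D_scaled factor_eq_1[OF oriented])

lemma alpha_D_eq: "heis_alpha (f q) (D q v) = heis_alpha q v"
  by (simp add: alpha_D factor_eq_1[OF oriented])

text \<open>The differential preserves \<open>\<omega>\<close>, so it preserves the kernel of \<open>\<omega>\<close>, which \<open>Z\<close> spans. From here
  on the horizontal part of \<open>f\<close> behaves like a map of \<open>\<real>\<^sup>2\<^sup>n\<close>.\<close>

lemma horiz_D_Z: "horiz (D q Z) = 0"
proof (rule sympl_nondegenerate)
  fix y
  obtain u where "y = S q u"
    by (rule surjE[OF surj_S])
  then show "sympl (horiz (D q Z)) y = 0"
    using omega_D_eq[of q Z "heis_frame q u"] by (simp add: heis_omega_sympl D_frame sympl_simps)
qed

lemma horiz_D: "horiz (D q v) = S q (horiz v)"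
proof -
  have "horiz (D q v) = horiz (D q (heis_frame q (horiz v) + heis_alpha q v *\<^sub>R Z))"
    using frame_decomposition[of v q] by simp
  then show ?thesis
    by (simp add: linear_add[OF linear_D] linear_cmul[OF linear_D] horiz_D_Z S_def)
qed

lemma horiz_D_has_derivative:
  "((\<lambda>p. horiz (D p w)) has_derivative (\<lambda>v. horiz (D2 q w v))) (at q)"
  by (rule bounded_linear.has_derivative[OF bounded_linear_horiz D_has_derivative])

text \<open>The rigidity of isometries of a flat metric, of any signature: \<open>T(u, v, w) = B(D\<^sup>2(u, v), D w)\<close>
  is symmetric in \<open>u\<close> and \<open>v\<close>, and differentiating the isometry equation shows that it is
  antisymmetric in \<open>u\<close> and \<open>w\<close>. A trilinear expression with both symmetries vanishes.\<close>

lemma horiz_D2: "horiz (D2 q v w) = 0"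
proof -
  define T where "T u v w = B (horiz (D2 q u v)) (horiz (D q w))" for u v w
  have sym: "T u v w = T v u w" for u v w
    by (simp only: T_def D2_commute[where q = q and v = u and w = v])
  have skew: "T u v w = - T w v u" for u v w
  proof -
    have bB: "bounded_bilinear B"
      using bilinear_flat_metric bilinear_conv_bounded_bilinear by blast
    have "((\<lambda>p. B (horiz (D p u)) (horiz (D p w))) has_derivative
        (\<lambda>v. B (horiz (D q u)) (horiz (D2 q w v)) + B (horiz (D2 q u v)) (horiz (D q w)))) (at q)"
      by (rule bounded_bilinear.FDERIV[OF bB horiz_D_has_derivative horiz_D_has_derivative])
    moreover have "(\<lambda>p. B (horiz (D p u)) (horiz (D p w))) = (\<lambda>p. B (horiz u) (horiz w))"
      by (simp add: horiz_D B_S)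
    ultimately have "((\<lambda>p. B (horiz u) (horiz w)) has_derivative
        (\<lambda>v. B (horiz (D q u)) (horiz (D2 q w v)) + B (horiz (D2 q u v)) (horiz (D q w)))) (at q)"
      by (simp only:)
    from fun_cong[OF has_derivative_unique[OF this has_derivative_const], of v] show ?thesis
      unfolding T_def flat_metric_commute[of _ "horiz (D2 q w v)"] by linarith
  qed
  \<comment> \<open>Alternating the two symmetries, \<open>T u v w = T v u w = - T w u v = - T u w v = T v w u = T w v u
    = - T u v w\<close>.\<close>
  have T: "T u v w = 0" for u v w
    using sym[of u v w] skew[of v u w] sym[of w u v] skew[of u w v] sym[of v w u] skew[of w v u]
    by linarith
  have "B (horiz (D2 q v w)) y = 0" for y
  proof -
    obtain u where "y = S q u"
      by (rule surjE[OF surj_S])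
    then show ?thesis
      using T[of v w "heis_of u 0"] by (simp add: T_def horiz_D)
  qed
  moreover have "case_sum t s k \<noteq> 0" for k
    using signs by (rule case_sum_signs_nonzero)
  ultimately show ?thesis
    using flat_metric_nondegenerate by blast
qed

lemma S_constant: "S q = S 0"
proof
  fix u
  have "\<exists>c. \<forall>p\<in>UNIV. horiz (D p (heis_of u 0)) = c"
    by (rule has_derivative_zero_constant)
      (use horiz_D_has_derivative[of "heis_of u 0"] in \<open>simp_all add: horiz_D2\<close>)
  then show "S q u = S 0 u"
    by (metis UNIV_I horiz_D horiz_heis_of)
qed

text \<open>The horizontal part of \<open>f\<close> is affine because its derivative is constant. The vertical part
  follows: preservation of \<open>\<alpha>\<close> expresses its derivative by the horizontal part, and the motion
  with the same horizontal part satisfies the same equation.\<close>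

lemma heis_motion:
  defines "\<sigma> \<equiv> matrix (S 0)"
  shows "\<sigma> \<in> Sp_omega" "\<sigma> \<in> O_metric g" "f = heis_motion (f 0) \<sigma>"
proof -
  have \<sigma>: "\<sigma> *v u = S q u" for u q
    unfolding \<sigma>_def S_constant[of q]
    using matrix_vector_mul(2)[OF linear_S] by metis
  show Sp: "\<sigma> \<in> Sp_omega" and "\<sigma> \<in> O_metric g"
    by (simp_all add: Sp_omega_iff O_metric_iff[OF metric] \<sigma>[of _ 0] sympl_S B_S
        factor_eq_1[OF oriented])
  let ?A = "heis_motion_linear (f 0) \<sigma>"
  have horiz_DA: "horiz (D q v) = horiz (?A v)" for q v
    by (simp add: horiz_D heis_motion_linear_def \<sigma>[of _ q])
  have hf: "horiz (f q) = horiz (f 0) + horiz (?A q)" for q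
  proof (rule affine_if_constant_derivative)
    show "((\<lambda>p. horiz (f p)) has_derivative (\<lambda>v. horiz (?A v))) (at r)" for r
      using bounded_linear.has_derivative[OF bounded_linear_horiz f_has_derivative[of r]]
      unfolding horiz_DA .
  qed
  have zc_DA: "zc (D q v) = zc (?A v)" for q v
  proof -
    have "heis_alpha (f q) (D q v) = heis_alpha (heis_motion (f 0) \<sigma> q) (?A v)"
      by (simp add: alpha_D_eq heis_motion_linear_alpha[OF Sp])
    then show ?thesis
      by (simp add: heis_alpha_sympl horiz_DA hf[of q] heis_motion_affine)
  qed
  have zf: "zc (f q) = zc (f 0) + zc (?A q)" for q
  proof (rule affine_if_constant_derivative)
    show "((\<lambda>p. zc (f p)) has_derivative (\<lambda>v. zc (?A v))) (at r)" for r
      using bounded_linear.has_derivative[OF bounded_linear_zc f_has_derivative[of r]]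
      unfolding zc_DA .
  qed
  show "f = heis_motion (f 0) \<sigma>"
  proof
    show "f q = heis_motion (f 0) \<sigma> q" for q
      unfolding heis_motion_affine heis_eq_iff using hf[of q] zf[of q] by simp
  qed
qed

end

section \<open>The group of orientation preserving isometries\<close>

theorem proposition3p6:
  fixes t s :: "'n::finite \<Rightarrow> real"
    and g :: "'n heis \<Rightarrow> 'n heis \<Rightarrow> 'n heis \<Rightarrow> real"
  assumes "\<And>i. t i \<in> {-1, 1}" and "\<And>i. s i \<in> {-1, 1}"
    and "heis_metric t s g"
  shows "group (oriented_isometry_group g)
    \<and> group (semidirect heis_group (SpO_group g) f_sigma)
    \<and> (\<lambda>(p, \<sigma>). heis_mult p \<circ> f_sigma \<sigma>)
        \<in> iso (semidirect heis_group (SpO_group g) f_sigma) (oriented_isometry_group g)"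
proof -
  let ?K = "semidirect heis_group (SpO_group g) f_sigma"
  let ?I = "oriented_isometry_group g"
  let ?\<Phi> = "\<lambda>(p, \<sigma>). heis_motion p \<sigma>"
  have K: "group ?K"
    by (rule group_heis_semidirect[OF assms(3)])
  have mem: "heis_motion p \<sigma> \<in> carrier ?I" if \<sigma>: "\<sigma> \<in> Sp_omega" "\<sigma> \<in> O_metric g" for p \<sigma>
  proof -
    note scale = orientation_forms_scale[of "heis_motion_linear p \<sigma>" 1, simplified,
        OF heis_motion_linear_omega[OF \<sigma>(1)] heis_motion_linear_alpha[OF \<sigma>(1)]]
    have "orientation_preserving (heis_motion p \<sigma>)"
      by (simp add: orientation_preserving_def pushforward_heis_motion scale)
    then show ?thesis
      using isometry_heis_motion[OF assms(3) \<sigma>] by (simp add: oriented_isometry_group_def)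
  qed
  have surj: "f \<in> ?\<Phi> ` carrier ?K" if "f \<in> carrier ?I" for f
  proof -
    interpret oriented_heis_isometry t s g f
      using that assms by unfold_locales (auto simp: oriented_isometry_group_def)
    have "f = ?\<Phi> (f 0, matrix (S 0))"
      using heis_motion(3) by (simp only: prod.case)
    moreover have "(f 0, matrix (S 0)) \<in> carrier ?K"
      using heis_motion(1,2) by (simp add: semidirect_def heis_group_def SpO_group_def)
    ultimately show ?thesis
      by (rule image_eqI)
  qed
  have hom: "?\<Phi> \<in> hom ?K ?I"
    using mem by (auto simp: hom_def semidirect_def heis_group_def SpO_group_def
        oriented_isometry_group_def heis_motion_compose)
  moreover have "bij_betw ?\<Phi> (carrier ?K) (carrier ?I)"
    unfolding bij_betw_def
  proof
    show "inj_on ?\<Phi> (carrier ?K)"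
    proof (rule inj_onI)
      fix x y assume "?\<Phi> x = ?\<Phi> y"
      then have "heis_motion (fst x) (snd x) = heis_motion (fst y) (snd y)"
        by (simp only: case_prod_unfold)
      then show "x = y"
        by (intro prod_eqI heis_motion_inject)
    qed
    show "?\<Phi> ` carrier ?K = carrier ?I"
      using surj hom_in_carrier[OF hom] by blast
  qed
  ultimately have iso: "?\<Phi> \<in> iso ?K ?I"
    by (rule isoI)
  have "?I\<lparr>one := ?\<Phi> \<one>\<^bsub>?K\<^esub>\<rparr> = ?I"
    by (simp add: oriented_isometry_group_def semidirect_def heis_group_def SpO_group_def
        heis_motion_id)
  then have "group ?I"
    using group.iso_imp_img_group[OF K iso] by simp
  with K iso show ?thesis
    by (simp add: heis_motion_def[abs_def])
qed

end
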